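(* Let $f_1,\dots,f_d$, the connected graph $\mathtt G$, the mixing matrix $W$, the parameters $\beta,\eta$ and all constants be as specified in the context (smoothness, network and parameter assumptions all in force). Let $\{(\mathbf X_k,\mathbf D_k)\}_{k\in\mathbb N}$ be the (infinite) sequence of stacked iterates generated by DESTINY from an initial guess $X_{\mathrm{initial}}\in\mathcal R$. Then $\{(\mathbf X_k,\mathbf D_k)\}$ has at least one accumulation point. Moreover, for any accumulation point $(\mathbf X^\ast,\mathbf D^\ast)$, one has $\mathbf X^\ast=(\mathbf 1_d\otimes I_n)\bar X^\ast$, where $\bar X^\ast\in\mathcal S_{n,p}$ is a first-order stationary point of $\min\{f(X): X\in\mathbb R^{n\times p},\ X^\top X=I_p\}$. Finally, there is a constant $\underline h\in\mathbb R$ (independent of $K$) such that for every integer $K\ge 1$, $$\min_{k=0,\dots,K-1}\|\bar{\mathbf X}_k-\mathbf X_k\|_{\mathrm F}^2\le\frac{16\,(\tilde h(\mathbf X_0,\mathbf D_0)-\underline h)}{3(1-\lambda^2)K},$$ $$\min_{k=0,\dots,K-1}\|G(\bar X_k)\|_{\mathrm F}^2\le\frac{2\,(\tilde h(\mathbf X_0,\mathbf D_0)-\underline h)}{\eta K},$$ $$\min_{k=0,\dots,K-1}\|\bar X_k^\top\bar X_k-I_p\|_{\mathrm F}^2\le\frac{2\,(\tilde h(\mathbf X_0,\mathbf D_0)-\underline h)}{\eta L_f^2K}$$ (the last bound being read as vacuous if $L_f=0$).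
   Context: Problem. $n,p,d$ are positive integers, $p\le n$, $[d]=\{1,\dots,d\}$, $\mathcal S_{n,p}=\{X\in\mathbb R^{n\times p}: X^\top X=I_p\}$. For $i\in[d]$, $f_i:\mathbb R^{n\times p}\to\mathbb R$ is smooth with locally Lipschitz continuous gradient $\nabla f_i$, and $f=\frac1d\sum_{i=1}^d f_i$. $\|\cdot\|_{\mathrm F}$ is the Frobenius norm, $\|\cdot\|_2$ the spectral norm, $\mathrm{sym}(B)=(B+B^\top)/2$, $\mathbf 1_d$ the all-ones vector, $\otimes$ the Kronecker product. A point $X\in\mathcal S_{n,p}$ is a first-order stationary point of $\min\{f(X): X\in\mathcal S_{n,p}\}$ if $\mathrm{grad}\,f(X):=\nabla f(X)-X\,\mathrm{sym}(X^\top\nabla f(X))=0$. Network. $\mathtt G=([d],\mathtt E)$ is a connected undirected graph; $W\in\mathbb R^{d\times d}$ is symmetric, entrywise nonnegative, $W\mathbf 1_d=W^\top\mathbf 1_d=\mathbf 1_d$, $W(i,j)=0$ whenever $i\ne j$ and $(i,j)\notin\mathtt E$, and $\lambda:=\|W-\mathbf 1_d\mathbf 1_d^\top/d\|_2<1$. Functions. $b(X)=\frac14\|X^\top X-I_p\|_{\mathrm F}^2$ (so $\nabla b(X)=X(X^\top X-I_p)$), $h(X)=\frac32 f(X)-\frac12 f(XX^\top X)+\beta b(X)$, $G_i(X)=\frac12\nabla f_i(XX^\top X)(3I_p-X^\top X)-X\,\mathrm{sym}(X^\top\nabla f_i(XX^\top X))$, $H_i(X)=G_i(X)+\beta X(X^\top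 X-I_p)$, $G=\frac1d\sum_i G_i$, $H=\frac1d\sum_i H_i$. Algorithm DESTINY. With stepsize $\eta>0$, penalty parameter $\beta>0$ and initial guess $X_{\mathrm{initial}}$: for all $i\in[d]$, $X_{i,0}=X_{\mathrm{initial}}$, $D_{i,0}=H_i(X_{i,0})$, and for $k\ge0$, $X_{i,k+1}=\sum_{j=1}^d W(i,j)(X_{j,k}-\eta D_{j,k})$, $D_{i,k+1}=\sum_{j=1}^d W(i,j)D_{j,k}+H_i(X_{i,k+1})-H_i(X_{i,k})$. Stacked and averaged quantities. $\bar X_k=\frac1d\sum_iX_{i,k}$, $\bar D_k=\frac1d\sum_iD_{i,k}$; $\mathbf X_k=[X_{1,k}^\top,\dots,X_{d,k}^\top]^\top$ and $\mathbf D_k=[D_{1,k}^\top,\dots,D_{d,k}^\top]^\top$ in $\mathbb R^{dn\times p}$; $\mathbf J=(\mathbf 1_d\mathbf 1_d^\top/d)\otimes I_n$; $\bar{\mathbf X}_k=\mathbf J\mathbf X_k=(\mathbf 1_d\otimes I_n)\bar X_k$, $\bar{\mathbf D}_k=\mathbf J\mathbf D_k=(\mathbf 1_d\otimes I_n)\bar D_k$. Merit function. $\tilde h(\mathbf X,\mathbf D)=h\big(\tfrac1d(\mathbf 1_d\otimes I_n)^\top\mathbf X\big)+\|\mathbf J\mathbf X-\mathbf X\|_{\mathrm F}^2+\rho\|\mathbf J\mathbf D-\mathbf D\|_{\mathrm F}^2$, with $\rho$ below. Sets and constants. $\mathcal R=\{X\in\mathbb R^{n\times p}:\|X^\top X-I_p\|_{\mathrm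 F}\le1/6\}$, $\mathcal B=\{X\in\mathbb R^{n\times p}:\|X\|_{\mathrm F}\le\sqrt{7dp/6}+\sqrt d\}$, $C_0=\sup_{X\in\mathcal R}\|\nabla f(XX^\top X)\|_{\mathrm F}$, $M_g=\sup\{\|G_i(X)\|_{\mathrm F}:X\in\mathcal B,i\in[d]\}$, $M_b=\sup\{\|\nabla b(X)\|_{\mathrm F}:X\in\mathcal B\}$, $L_g=\sup\{\|G_i(X)-G_i(Y)\|_{\mathrm F}/\|X-Y\|_{\mathrm F}:X\ne Y,\ X,Y\in\mathcal B,\ i\in[d]\}$, $L_b=\sup\{\|\nabla b(X)-\nabla b(Y)\|_{\mathrm F}/\|X-Y\|_{\mathrm F}:X\neq Y,\ X,Y\in\mathcal B\}$, $L_f=\sup\{\|\nabla f(X)-\nabla f(XX^\top X)\|_{\mathrm F}/\|X(X^\top X-I_p)\|_{\mathrm F}:X\in\mathcal B,\ X\ne XX^\top X\}$, $C_1=\frac{\lambda^2(1+\lambda^2)}{1-\lambda^2}$, $C_D=\|\bar{\mathbf D}_0-\mathbf D_0\|_{\mathrm F}+\frac{3\sqrt d}{1-\lambda}+\sqrt d(M_g+\beta M_b)$, $C_2=\frac{12(1+\lambda^2)(L_g+\beta L_b)^2}{1-\lambda^2}$, $\rho=\frac{3}{16C_2}(1-\lambda^2)$. Parameter assumptions. $\beta>\max\{\frac{6+21C_0}{5},\frac{72(4+3M_g)}{5},\frac1{L_b},22L_f^2\}$ and $0<\eta<\min\{\bar\eta_1,\dots,\bar\eta_{12}\}$, where, with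 $L:=L_g+\beta L_b$: $\bar\eta_1=\frac{216}{49\beta^2}$, $\bar\eta_2=\frac{12}{7\beta}$, $\bar\eta_3=\frac1{18(4+3M_g)}$, $\bar\eta_4=\frac{5\beta/72-4-3M_g}{(1+M_g)^2}$, $\bar\eta_5=\frac{\sqrt d(1-\lambda)}{L\lambda C_D}$, $\bar\eta_6=\frac{\sqrt d}{LC_D}$, $\bar\eta_7=\frac1{8L}$, $\bar\eta_8=\frac1{4\rho dC_2}$, $\bar\eta_9=\frac{1-\lambda^2}{2\lambda^2L}\sqrt{\frac1{6(1+\lambda^2)}}$, $\bar\eta_{10}=\sqrt{\frac{d(1-\lambda^2)}{24L^3}}$, $\bar\eta_{11}=\frac{d(1-\lambda^2)}{12L^2}$, $\bar\eta_{12}=\sqrt{\frac{3\rho(1-\lambda^2)}{16C_1}}$. An $\bar\eta_j$ with zero denominator (only possible when $\lambda=0$) is read as $+\infty$. *)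

theory Defs
  imports "HOL-Analysis.Analysis"
begin

text \<open>
  An \<open>n \<times> p\<close> matrix is an element of \<open>real^'p^'n\<close>; its \<open>norm\<close> and \<open>inner\<close> product are
  the Frobenius ones. The agents \<open>[d]\<close> are the elements of a finite type \<open>'d\<close>, and a
  \<open>dn \<times> p\<close> matrix is an element of \<open>real^'p^('d \<times> 'n)\<close>, row \<open>(i, a)\<close> being row
  \<open>a\<close> of block \<open>i\<close>.
\<close>

section \<open>Matrices\<close>

definition sym_part :: "real^'p^'p \<Rightarrow> real^'p^'p" where
  "sym_part B = (1 / 2) *\<^sub>R (B + transpose B)"

definition spectral_norm :: "real^'m^'n \<Rightarrow> real" where
  "spectral_norm A = onorm (\<lambda>v. A *v v)"

definition kron :: "real^'b^'a \<Rightarrow> real^'n^'m \<Rightarrow> real^('b::finite \<times> 'n::finite)^('a::finite \<times> 'm::finite)" where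
  "kron A B = (\<chi> r c. A $ fst r $ fst c * B $ snd r $ snd c)"

text \<open>The Kronecker product \<open>v \<otimes> B\<close> with a column vector \<open>v\<close>; the column index
  \<open>1 \<times> 'n\<close> is identified with \<open>'n\<close>. Note that \<open>1 :: real^'d\<close> is the all-ones vector.\<close>

definition kron_vec :: "real^'d \<Rightarrow> real^'n^'m \<Rightarrow> real^'n^('d \<times> 'm)" where
  "kron_vec v B = (\<chi> r c. v $ fst r * B $ snd r $ c)"

definition stack :: "('d::finite \<Rightarrow> real^'p^'n) \<Rightarrow> real^'p^('d \<times> 'n)" where
  "stack X = (\<chi> r. X (fst r) $ snd r)"

definition avg :: "('d::finite \<Rightarrow> 'a::real_vector) \<Rightarrow> 'a" where
  "avg x = (1 / real CARD('d)) *\<^sub>R (\<Sum>i\<in>UNIV. x i)"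

text \<open>\<open>1 1\<^sup>T / d\<close>\<close>

definition avg_matrix :: "real^'d^'d" where
  "avg_matrix = (\<chi> i j. 1 / real CARD('d))"

definition J_mat :: "real^('d::finite \<times> 'n::finite)^('d \<times> 'n)" where
  "J_mat = kron avg_matrix (mat 1)"

definition replicate_blocks :: "real^'p^'n \<Rightarrow> real^'p^('d::finite \<times> 'n::finite)" where
  "replicate_blocks X = (kron_vec 1 (mat 1) :: real^'n^('d \<times> 'n)) ** X"

definition block_mean :: "real^'p^('d::finite \<times> 'n::finite) \<Rightarrow> real^'p^'n" where
  "block_mean Z =
     (1 / real CARD('d)) *\<^sub>R (transpose (kron_vec 1 (mat 1) :: real^'n^('d \<times> 'n)) ** Z)"

definition stiefel :: "(real^'p^'n) set" where
  "stiefel = {X. transpose X ** X = mat 1}"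


section \<open>Gradients and stationarity\<close>

definition gradient :: "('a::real_inner \<Rightarrow> real) \<Rightarrow> 'a \<Rightarrow> 'a" where
  "gradient f x = (THE g. GDERIV f x :> g)"

definition has_loc_lipschitz_gradient :: "('a::real_inner \<Rightarrow> real) \<Rightarrow> bool" where
  "has_loc_lipschitz_gradient f \<longleftrightarrow>
     (\<forall>x. \<exists>g. GDERIV f x :> g) \<and>
     (\<forall>x. \<exists>r>0. \<exists>L. L-lipschitz_on (ball x r) (gradient f))"

definition riem_grad :: "(real^'p^'n \<Rightarrow> real) \<Rightarrow> real^'p^'n \<Rightarrow> real^'p^'n" where
  "riem_grad f X = gradient f X - X ** sym_part (transpose X ** gradient f X)"

definition first_order_stationary :: "(real^'p^'n \<Rightarrow> real) \<Rightarrow> real^'p^'n \<Rightarrow> bool" where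
  "first_order_stationary f X \<longleftrightarrow> X \<in> stiefel \<and> riem_grad f X = 0"


section \<open>Network\<close>

text \<open>An undirected graph on \<open>'d\<close> is given by its symmetric adjacency relation.\<close>

definition connected_graph :: "('d \<times> 'd) set \<Rightarrow> bool" where
  "connected_graph E \<longleftrightarrow> sym E \<and> (\<forall>i j. (i, j) \<in> E\<^sup>*)"

definition mixing_rate :: "real^'d^'d \<Rightarrow> real" where
  "mixing_rate W = spectral_norm (W - avg_matrix)"

definition mixing_matrix :: "('d \<times> 'd) set \<Rightarrow> real^'d^'d \<Rightarrow> bool" where
  "mixing_matrix E W \<longleftrightarrow>
     transpose W = W \<and> (\<forall>i j. 0 \<le> W $ i $ j) \<and>
     W *v 1 = 1 \<and> transpose W *v 1 = 1 \<and>
     (\<forall>i j. i \<noteq> j \<and> (i, j) \<notin> E \<longrightarrow> W $ i $ j = 0) \<and>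
     mixing_rate W < 1"


section \<open>Objective, penalty and search directions\<close>

definition objective :: "('d::finite \<Rightarrow> real^'p^'n \<Rightarrow> real) \<Rightarrow> real^'p^'n \<Rightarrow> real" where
  "objective f X = avg (\<lambda>i. f i X)"

definition cube :: "real^'p^'n \<Rightarrow> real^'p^'n" where
  "cube X = X ** transpose X ** X"

definition b_pen :: "real^'p^'n \<Rightarrow> real" where
  "b_pen X = (1 / 4) * (norm (transpose X ** X - mat 1))\<^sup>2"

definition h_fun :: "('d::finite \<Rightarrow> real^'p^'n \<Rightarrow> real) \<Rightarrow> real \<Rightarrow> real^'p^'n \<Rightarrow> real" where
  "h_fun f \<beta> X = 3 / 2 * objective f X - 1 / 2 * objective f (cube X) + \<beta> * b_pen X"

definition G_loc :: "(real^'p^'n \<Rightarrow> real) \<Rightarrow> real^'p^'n \<Rightarrow> real^'p^'n" where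
  "G_loc g X =
     (1 / 2) *\<^sub>R (gradient g (cube X) ** (3 *\<^sub>R mat 1 - transpose X ** X))
     - X ** sym_part (transpose X ** gradient g (cube X))"

definition H_loc :: "(real^'p^'n \<Rightarrow> real) \<Rightarrow> real \<Rightarrow> real^'p^'n \<Rightarrow> real^'p^'n" where
  "H_loc g \<beta> X = G_loc g X + \<beta> *\<^sub>R (X ** (transpose X ** X - mat 1))"

definition G_avg :: "('d::finite \<Rightarrow> real^'p^'n \<Rightarrow> real) \<Rightarrow> real^'p^'n \<Rightarrow> real^'p^'n" where
  "G_avg f X = avg (\<lambda>i. G_loc (f i) X)"


section \<open>Algorithm\<close>

definition destiny_iterates ::
  "('d::finite \<Rightarrow> real^'p^'n \<Rightarrow> real) \<Rightarrow> real^'d^'d \<Rightarrow> real \<Rightarrow> real \<Rightarrow> real^'p^'n \<Rightarrow>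
   (nat \<Rightarrow> 'd \<Rightarrow> real^'p^'n) \<Rightarrow> (nat \<Rightarrow> 'd \<Rightarrow> real^'p^'n) \<Rightarrow> bool" where
  "destiny_iterates f W \<beta> \<eta> X_init X D \<longleftrightarrow>
     (\<forall>i. X 0 i = X_init) \<and>
     (\<forall>i. D 0 i = H_loc (f i) \<beta> (X 0 i)) \<and>
     (\<forall>k i. X (Suc k) i = (\<Sum>j\<in>UNIV. W $ i $ j *\<^sub>R (X k j - \<eta> *\<^sub>R D k j))) \<and>
     (\<forall>k i. D (Suc k) i = (\<Sum>j\<in>UNIV. W $ i $ j *\<^sub>R D k j)
                            + H_loc (f i) \<beta> (X (Suc k) i) - H_loc (f i) \<beta> (X k i))"


section \<open>Sets and constants\<close>

definition region_R :: "(real^'p^'n) set" where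
  "region_R = {X. norm (transpose X ** X - mat 1) \<le> 1 / 6}"

text \<open>
  Below, an argument \<open>f\<close> not occurring on the right-hand side only supplies the dimensions
  \<open>d\<close>, \<open>n\<close>, \<open>p\<close>. When the gradients of the \<open>f i\<close> are locally Lipschitz and \<open>p \<le> n\<close>, all
  sets whose supremum is taken are nonempty and bounded above, so that the real \<open>Sup\<close> is the
  actual supremum.
\<close>

definition region_B :: "('d::finite \<Rightarrow> real^'p^'n \<Rightarrow> real) \<Rightarrow> (real^'p^'n) set" where
  "region_B f = {X. norm X \<le> sqrt (7 * real CARD('d) * real CARD('p) / 6) + sqrt (real CARD('d))}"

definition C0 :: "('d::finite \<Rightarrow> real^'p^'n \<Rightarrow> real) \<Rightarrow> real" where
  "C0 f = Sup {norm (gradient (objective f) (cube X)) | X. X \<in> region_R}"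

definition M_g :: "('d::finite \<Rightarrow> real^'p^'n \<Rightarrow> real) \<Rightarrow> real" where
  "M_g f = Sup {norm (G_loc (f i) X) | X i. X \<in> region_B f}"

definition M_b :: "('d::finite \<Rightarrow> real^'p^'n \<Rightarrow> real) \<Rightarrow> real" where
  "M_b f = Sup {norm (gradient b_pen X) | X. X \<in> region_B f}"

definition L_g :: "('d::finite \<Rightarrow> real^'p^'n \<Rightarrow> real) \<Rightarrow> real" where
  "L_g f = Sup {norm (G_loc (f i) X - G_loc (f i) Y) / norm (X - Y) | X Y i.
                  X \<noteq> Y \<and> X \<in> region_B f \<and> Y \<in> region_B f}"

definition L_b :: "('d::finite \<Rightarrow> real^'p^'n \<Rightarrow> real) \<Rightarrow> real" where
  "L_b f = Sup {norm (gradient b_pen X - gradient b_pen Y) / norm (X - Y) | X Y.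
                  X \<noteq> Y \<and> X \<in> region_B f \<and> Y \<in> region_B f}"

definition L_f :: "('d::finite \<Rightarrow> real^'p^'n \<Rightarrow> real) \<Rightarrow> real" where
  "L_f f = Sup {norm (gradient (objective f) X - gradient (objective f) (cube X))
                  / norm (X ** (transpose X ** X - mat 1)) | X.
                  X \<in> region_B f \<and> X \<noteq> cube X}"

definition L_tot :: "('d::finite \<Rightarrow> real^'p^'n \<Rightarrow> real) \<Rightarrow> real \<Rightarrow> real" where
  "L_tot f \<beta> = L_g f + \<beta> * L_b f"

definition C1 :: "real^'d^'d \<Rightarrow> real" where
  "C1 W = (let l = mixing_rate W in l\<^sup>2 * (1 + l\<^sup>2) / (1 - l\<^sup>2))"

definition C2 :: "('d::finite \<Rightarrow> real^'p^'n \<Rightarrow> real) \<Rightarrow> real^'d^'d \<Rightarrow> real \<Rightarrow> real" where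
  "C2 f W \<beta> = (let l = mixing_rate W in 12 * (1 + l\<^sup>2) * (L_tot f \<beta>)\<^sup>2 / (1 - l\<^sup>2))"

definition rho :: "('d::finite \<Rightarrow> real^'p^'n \<Rightarrow> real) \<Rightarrow> real^'d^'d \<Rightarrow> real \<Rightarrow> real" where
  "rho f W \<beta> = 3 / (16 * C2 f W \<beta>) * (1 - (mixing_rate W)\<^sup>2)"

definition C_D ::
  "('d::finite \<Rightarrow> real^'p^'n \<Rightarrow> real) \<Rightarrow> real^'d^'d \<Rightarrow> real \<Rightarrow> real^'p^('d \<times> 'n) \<Rightarrow> real" where
  "C_D f W \<beta> D0 =
     norm (J_mat ** D0 - D0) + 3 * sqrt (real CARD('d)) / (1 - mixing_rate W)
     + sqrt (real CARD('d)) * (M_g f + \<beta> * M_b f)"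

definition merit ::
  "('d::finite \<Rightarrow> real^'p^'n \<Rightarrow> real) \<Rightarrow> real^'d^'d \<Rightarrow> real \<Rightarrow>
   real^'p^('d \<times> 'n) \<Rightarrow> real^'p^('d \<times> 'n) \<Rightarrow> real" where
  "merit f W \<beta> X D =
     h_fun f \<beta> (block_mean X) + (norm (J_mat ** X - X))\<^sup>2
     + rho f W \<beta> * (norm (J_mat ** D - D))\<^sup>2"


section \<open>Parameter conditions\<close>

definition penalty_condition :: "('d::finite \<Rightarrow> real^'p^'n \<Rightarrow> real) \<Rightarrow> real \<Rightarrow> bool" where
  "penalty_condition f \<beta> \<longleftrightarrow>
     \<beta> > 0 \<and>
     \<beta> > Max {(6 + 21 * C0 f) / 5, 72 * (4 + 3 * M_g f) / 5, 1 / L_b f, 22 * (L_f f)\<^sup>2}"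

text \<open>
  The three guarded bounds have a denominator that vanishes when the mixing rate is zero; they
  then count as \<open>\<infinity>\<close>. The denominators of the other bounds are nonzero under
  \<open>penalty_condition\<close> and \<open>mixing_matrix\<close>.
\<close>

definition stepsize_condition ::
  "('d::finite \<Rightarrow> real^'p^'n \<Rightarrow> real) \<Rightarrow> real^'d^'d \<Rightarrow> real \<Rightarrow> real^'p^('d \<times> 'n) \<Rightarrow> real \<Rightarrow> bool" where
  "stepsize_condition f W \<beta> D0 \<eta> \<longleftrightarrow>
    (let d = real CARD('d); l = mixing_rate W; L = L_tot f \<beta>; M = M_g f;
         CD = C_D f W \<beta> D0; r = rho f W \<beta> in
     0 < \<eta> \<and>
     \<eta> < 216 / (49 * \<beta>\<^sup>2) \<and>
     \<eta> < 12 / (7 * \<beta>) \<and>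
     \<eta> < 1 / (18 * (4 + 3 * M)) \<and>
     \<eta> < (5 * \<beta> / 72 - 4 - 3 * M) / (1 + M)\<^sup>2 \<and>
     (l \<noteq> 0 \<longrightarrow> \<eta> < sqrt d * (1 - l) / (L * l * CD)) \<and>
     \<eta> < sqrt d / (L * CD) \<and>
     \<eta> < 1 / (8 * L) \<and>
     \<eta> < 1 / (4 * r * d * C2 f W \<beta>) \<and>
     (l \<noteq> 0 \<longrightarrow> \<eta> < (1 - l\<^sup>2) / (2 * l\<^sup>2 * L) * sqrt (1 / (6 * (1 + l\<^sup>2)))) \<and>
     \<eta> < sqrt (d * (1 - l\<^sup>2) / (24 * L ^ 3)) \<and>
     \<eta> < d * (1 - l\<^sup>2) / (12 * L\<^sup>2) \<and>
     (l \<noteq> 0 \<longrightarrow> \<eta> < sqrt (3 * r * (1 - l\<^sup>2) / (16 * C1 W))))"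

definition accumulation_point :: "(nat \<Rightarrow> 'a::topological_space) \<Rightarrow> 'a \<Rightarrow> bool" where
  "accumulation_point s l \<longleftrightarrow> (\<exists>r. strict_mono r \<and> (s \<circ> r) \<longlonglongrightarrow> l)"

end

theory Submission imports Defs begin

text \<open>
  DESTINY is gradient tracking applied to the directions \<open>H_loc (f i) \<beta>\<close>, whose average \<open>H\<close>
  is an approximate gradient of the penalised objective \<open>h\<close>. Averaging the recursion turns it
  into a perturbed descent step \<open>X' = X - \<eta> D\<close> for the mean iterate, where the mean direction
  \<open>D\<close> differs from \<open>H X\<close> by at most a multiple of the disagreement between the agents. The
  proof has three ingredients.

  \<^item> \<^emph>\<open>The iterates stay where the constants are valid.\<close> By induction (\<open>controlled\<close>), the mean
    iterate stays in the region \<open>\<parallel>X\<^sup>T X - I\<parallel> \<le> 1 / 6\<close> around the Stiefel manifold, the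
    disagreement of the \<open>X\<close>-blocks stays below \<open>\<surd>d / L\<close>, which keeps the tracking error
    below \<open>1\<close>, and the \<open>D\<close>-blocks stay bounded. The mean iterate cannot leave the region
    because the penalty contracts \<open>X\<^sup>T X - I\<close> at a rate proportional to \<open>\<eta> \<beta>\<close>, which
    outweighs the push of \<open>G\<close> and of the tracking error for large \<open>\<beta>\<close>
    (\<open>region_R_step\<close>).

  \<^item> \<^emph>\<open>The penalised objective decreases up to the disagreement\<close> (\<open>h_fun_descent\<close>). The
    gradient of \<open>h\<close> is \<open>H\<close> plus \<open>3 / 2\<close> times the gap between \<open>\<nabla>f X\<close> and
    \<open>\<nabla>f (X X\<^sup>T X)\<close>. The gap has norm at most \<open>L_f\<close> times that of the penalty gradient, and it is
    estimated in this form at every point of the segment from \<open>X\<close> to \<open>X'\<close>; the curvature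
    constant of the step then involves \<open>L_f\<close> and the Lipschitz constants of \<open>H\<close> and of the penalty
    gradient. On the other hand \<open>G\<close> and the penalty gradient are nearly orthogonal, so that
    \<open>\<parallel>H\<parallel>\<^sup>2\<close> controls both \<open>\<parallel>G\<parallel>\<^sup>2\<close> and \<open>\<beta> \<parallel>X\<^sup>T X - I\<parallel>\<^sup>2\<close>
    (\<open>norm_sq_H_lower_bound\<close>), and \<open>\<beta> > 22 L_f\<^sup>2\<close> absorbs the gap.

  \<^item> \<^emph>\<open>The disagreements contract.\<close> Mixing shrinks them by the factor \<open>mixing_rate W\<close>, and
    what the step adds is controlled by the disagreements and the mean direction. The merit
    function weighs the three quantities so that all the cross terms are absorbed
    (\<open>merit_descent\<close>).

  The merit function is bounded below along the iterates, so the decreases are summable. Hence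
  the disagreement, \<open>G\<close> at the mean iterate and \<open>X\<^sup>T X - I\<close> at the mean iterate tend to
  zero, which identifies the limit points; comparing a minimum with an average gives the rates.
\<close>

unbundle inner_syntax

section \<open>Frobenius geometry of matrix products\<close>

lemma frobenius_inner: "(A::real^'m^'n) \<bullet> B = (\<Sum>i\<in>UNIV. \<Sum>j\<in>UNIV. A $ i $ j * B $ i $ j)"
  by (simp add: inner_vec_def)

lemma inner_transpose [simp]: "transpose (A::real^'m^'n) \<bullet> transpose B = A \<bullet> B"
  unfolding frobenius_inner transpose_def by (subst sum.swap) simp

lemma norm_transpose [simp]: "norm (transpose (A::real^'m^'n)) = norm A"
  by (simp add: norm_eq_sqrt_inner)

lemma inner_matrix_mult_left:
  "((A::real^'m^'n) ** (B::real^'k^'m)) \<bullet> C = B \<bullet> (transpose A ** C)"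
proof -
  have "(A ** B) \<bullet> C = (\<Sum>i\<in>UNIV. \<Sum>j\<in>UNIV. \<Sum>k\<in>UNIV. A $ i $ k * B $ k $ j * C $ i $ j)"
    by (simp add: frobenius_inner matrix_matrix_mult_def sum_distrib_right)
  also have "\<dots> = (\<Sum>j\<in>UNIV. \<Sum>i\<in>UNIV. \<Sum>k\<in>UNIV. A $ i $ k * B $ k $ j * C $ i $ j)"
    by (rule sum.swap)
  also have "\<dots> = (\<Sum>j\<in>UNIV. \<Sum>k\<in>UNIV. \<Sum>i\<in>UNIV. A $ i $ k * B $ k $ j * C $ i $ j)"
    by (intro sum.cong refl sum.swap)
  also have "\<dots> = (\<Sum>k\<in>UNIV. \<Sum>j\<in>UNIV. \<Sum>i\<in>UNIV. A $ i $ k * B $ k $ j * C $ i $ j)"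
    by (rule sum.swap)
  also have "\<dots> = B \<bullet> (transpose A ** C)"
    by (simp add: frobenius_inner matrix_matrix_mult_def transpose_def sum_distrib_left mult_ac)
  finally show ?thesis .
qed

lemma inner_matrix_mult_right:
  "((A::real^'m^'n) ** (B::real^'k^'m)) \<bullet> C = A \<bullet> (C ** transpose B)"
proof -
  have "(A ** B) \<bullet> C = transpose (A ** B) \<bullet> transpose C"
    by simp
  also have "\<dots> = transpose A \<bullet> (B ** transpose C)"
    by (simp add: matrix_transpose_mul inner_matrix_mult_left del: inner_transpose)
  also have "\<dots> = transpose A \<bullet> transpose (C ** transpose B)"
    by (simp add: matrix_transpose_mul del: inner_transpose)
  finally show ?thesis by simp
qed

lemma norm_matrix_mult_le: "norm ((A::real^'m^'n) ** (B::real^'k^'m)) \<le> norm A * norm B"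
proof (rule power2_le_imp_le)
  have entry: "((A ** B) $ i $ j)\<^sup>2 \<le> (\<Sum>k\<in>UNIV. (A $ i $ k)\<^sup>2) * (\<Sum>k\<in>UNIV. (B $ k $ j)\<^sup>2)" for i j
    by (simp add: matrix_matrix_mult_def Cauchy_Schwarz_ineq_sum)
  have sq: "(norm (M::real^'y^'x))\<^sup>2 = (\<Sum>i\<in>UNIV. \<Sum>j\<in>UNIV. (M $ i $ j)\<^sup>2)" for M
    unfolding power2_norm_eq_inner frobenius_inner by (simp add: power2_eq_square)
  have "(norm (A ** B))\<^sup>2 \<le>
      (\<Sum>i\<in>UNIV. \<Sum>j\<in>UNIV. (\<Sum>k\<in>UNIV. (A $ i $ k)\<^sup>2) * (\<Sum>k\<in>UNIV. (B $ k $ j)\<^sup>2))"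
    unfolding sq by (intro sum_mono entry)
  also have "\<dots> = (\<Sum>i\<in>UNIV. \<Sum>k\<in>UNIV. (A $ i $ k)\<^sup>2) * (\<Sum>j\<in>UNIV. \<Sum>k\<in>UNIV. (B $ k $ j)\<^sup>2)"
    by (simp only: sum_product)
  also have "\<dots> = (norm A * norm B)\<^sup>2"
    unfolding power_mult_distrib sq by (subst (2) sum.swap) simp
  finally show "(norm (A ** B))\<^sup>2 \<le> (norm A * norm B)\<^sup>2" .
qed simp

lemma bounded_bilinear_matrix_mult:
  "bounded_bilinear (\<lambda>(A::real^'m^'n) (B::real^'k^'m). A ** B)"
proof
  show "\<exists>K. \<forall>(A::real^'m^'n) (B::real^'k^'m). norm (A ** B) \<le> norm A * norm B * K"
    by (rule exI[of _ 1]) (simp add: norm_matrix_mult_le)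
qed (simp_all add: vec_eq_iff matrix_matrix_mult_def sum.distrib algebra_simps sum_distrib_left)

lemmas matrix_mult_simps =
  bounded_bilinear.add_left[OF bounded_bilinear_matrix_mult]
  bounded_bilinear.add_right[OF bounded_bilinear_matrix_mult]
  bounded_bilinear.diff_left[OF bounded_bilinear_matrix_mult]
  bounded_bilinear.diff_right[OF bounded_bilinear_matrix_mult]
  bounded_bilinear.minus_left[OF bounded_bilinear_matrix_mult]
  bounded_bilinear.minus_right[OF bounded_bilinear_matrix_mult]
  bounded_bilinear.scaleR_left[OF bounded_bilinear_matrix_mult]
  bounded_bilinear.scaleR_right[OF bounded_bilinear_matrix_mult]

lemma bounded_linear_transpose: "bounded_linear (transpose :: real^'m^'n \<Rightarrow> real^'n^'m)"
  by (rule bounded_linear_intro[where K = 1]) (simp_all, simp_all add: vec_eq_iff transpose_def)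

lemmas transpose_simps =
  bounded_linear.linear[OF bounded_linear_transpose, THEN linear_add]
  bounded_linear.linear[OF bounded_linear_transpose, THEN linear_diff]
  bounded_linear.linear[OF bounded_linear_transpose, THEN linear_scale]

lemma norm_matrix_mult_le_of:
  "norm (A::real^'m^'n) \<le> a \<Longrightarrow> norm (B::real^'k^'m) \<le> b \<Longrightarrow> norm (A ** B) \<le> a * b"
  by (rule order_trans[OF norm_matrix_mult_le mult_mono]) (auto intro: order_trans[OF norm_ge_zero])

lemma norm_sym_part_le: "norm (sym_part B) \<le> norm (B::real^'p^'p)"
  unfolding sym_part_def using norm_triangle_ineq[of B "transpose B"] by simp

lemma inner_sym_part:
  assumes "transpose S = (S::real^'p^'p)"
  shows "sym_part B \<bullet> S = B \<bullet> S"
  using inner_transpose[of B S] assms by (simp add: sym_part_def inner_add_left)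

lemma sym_part_add: "sym_part (A + B) = sym_part A + sym_part (B::real^'p^'p)"
  by (simp add: sym_part_def transpose_simps algebra_simps)

lemma sym_part_scaleR: "sym_part (c *\<^sub>R B) = c *\<^sub>R sym_part (B::real^'p^'p)"
  by (simp add: sym_part_def transpose_simps algebra_simps)

text \<open>
  The distance to the Stiefel manifold is measured by this symmetric matrix. Every occurrence of
  \<open>X\<^sup>T X\<close> is written as \<open>I\<close> plus it, which turns estimates near the manifold into
  estimates in powers of a small matrix.
\<close>

definition defect :: "real^'p^'n \<Rightarrow> real^'p^'p" where
  "defect X = transpose X ** X - mat 1"

lemma gram_eq: "transpose X ** X = mat 1 + defect X"
  by (simp add: defect_def)

lemma transpose_defect [simp]: "transpose (defect X) = defect X"
  by (simp add: defect_def transpose_simps matrix_transpose_mul)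

lemma cube_eq: "cube X = X + X ** defect X"
  by (simp add: cube_def defect_def matrix_mult_simps matrix_mul_assoc)

lemma norm_sq_matrix_mult:
  "(norm ((X::real^'p^'n) ** (M::real^'k^'p)))\<^sup>2 = (norm M)\<^sup>2 + M \<bullet> (defect X ** M)"
  by (simp add: power2_norm_eq_inner inner_matrix_mult_left matrix_mul_assoc gram_eq
      matrix_mult_simps inner_add_right)

lemma defect_quadratic_bound:
  assumes "norm (defect X) \<le> e"
  shows "\<bar>M \<bullet> (defect X ** M)\<bar> \<le> e * (norm (M::real^'k^'p))\<^sup>2"
proof -
  have "\<bar>M \<bullet> (defect X ** M)\<bar> \<le> norm M * norm (defect X ** M)"
    by (rule Cauchy_Schwarz_ineq2)
  also have "\<dots> \<le> norm M * (e * norm M)"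
    by (intro mult_left_mono norm_matrix_mult_le_of assms) auto
  finally show ?thesis by (simp add: power2_eq_square mult_ac)
qed

lemma region_R_iff: "X \<in> region_R \<longleftrightarrow> norm (defect X) \<le> 1 / 6"
  by (simp add: region_R_def defect_def)

lemma norm_sq_mult_region_R:
  assumes "X \<in> region_R"
  shows "(norm (X ** M))\<^sup>2 \<le> 7 / 6 * (norm (M::real^'k^'p))\<^sup>2"
    and "5 / 6 * (norm M)\<^sup>2 \<le> (norm (X ** M))\<^sup>2"
  using defect_quadratic_bound[of X "1/6" M] assms
  by (auto simp: region_R_iff norm_sq_matrix_mult abs_le_iff)

lemma norm_mult_region_R:
  assumes "X \<in> region_R"
  shows "norm (X ** (M::real^'k^'p)) \<le> 13 / 12 * norm M"
proof (rule power2_le_imp_le)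
  have "(norm (X ** M))\<^sup>2 \<le> 7 / 6 * (norm M)\<^sup>2"
    by (rule norm_sq_mult_region_R[OF assms])
  also have "\<dots> \<le> (13 / 12)\<^sup>2 * (norm M)\<^sup>2"
    by (rule mult_right_mono) (simp_all add: power2_eq_square)
  finally show "(norm (X ** M))\<^sup>2 \<le> (13 / 12 * norm M)\<^sup>2"
    by (simp only: power_mult_distrib)
qed simp

text \<open>
  The factor is a bound on the spectral norm of \<open>X\<close>. Submultiplicativity of the Frobenius norm
  would give a factor of order \<open>\<surd>p\<close> instead, too large for the dimension-free conditions on
  \<open>\<beta>\<close>. The bound for the transpose follows from that for \<open>X\<close> by duality; \<open>13 / 12\<close> is a
  rational upper bound of \<open>\<surd>(7 / 6)\<close>.
\<close>

lemma norm_transpose_mult_region_R: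
  assumes "X \<in> region_R"
  shows "norm (transpose X ** (S::real^'k^'n)) \<le> 13 / 12 * norm S"
proof -
  let ?T = "transpose X ** S"
  have "(norm ?T)\<^sup>2 = (X ** ?T) \<bullet> S"
    by (simp add: power2_norm_eq_inner inner_matrix_mult_left)
  also have "\<dots> \<le> norm (X ** ?T) * norm S"
    by (rule norm_cauchy_schwarz)
  also have "\<dots> \<le> (13 / 12 * norm ?T) * norm S"
    by (intro mult_right_mono norm_mult_region_R assms) auto
  finally have "norm ?T * norm ?T \<le> norm ?T * (13 / 12 * norm S)"
    by (simp add: power2_eq_square mult_ac)
  then show ?thesis
    by (metis mult_le_cancel_left_pos norm_ge_zero norm_zero zero_less_norm_iff mult_nonneg_nonneg
        zero_le_numeral divide_nonneg_nonneg)
qed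

lemma norm_region_R:
  assumes "(X::real^'p^'n) \<in> region_R"
  shows "norm X \<le> sqrt (7 * real CARD('p) / 6)"
proof -
  have I: "(norm (mat 1 :: real^'p^'p))\<^sup>2 = real CARD('p)"
    by (simp add: power2_norm_eq_inner frobenius_inner mat_def if_distrib cong: if_cong)
  have "(norm (X ** (mat 1 :: real^'p^'p)))\<^sup>2 \<le> 7 / 6 * (norm (mat 1 :: real^'p^'p))\<^sup>2"
    by (rule norm_sq_mult_region_R[OF assms])
  then have "(norm X)\<^sup>2 \<le> 7 * real CARD('p) / 6"
    using I by (simp add: mult_ac)
  then show ?thesis
    by (rule real_le_rsqrt)
qed

section \<open>Gradients of the objective and of its penalised form\<close>

lemma gradient_eqI:
  assumes "GDERIV f x :> g"
  shows "gradient f x = g"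
  unfolding gradient_def
proof (rule the_equality)
  show "GDERIV f x :> g" by fact
  fix g' assume "GDERIV f x :> g'"
  then have "(\<lambda>h. h \<bullet> g') = (\<lambda>h. h \<bullet> g)"
    using assms unfolding gderiv_def by (rule has_derivative_unique)
  then show "g' = g"
    by (metis inner_commute vector_eq_rdot)
qed

lemma GDERIV_gradient:
  "has_loc_lipschitz_gradient f \<Longrightarrow> GDERIV f x :> gradient f x"
  unfolding has_loc_lipschitz_gradient_def using gradient_eqI by metis

text \<open>
  Local Lipschitz constants can be chosen uniformly on a compact set, whether or not it is convex.
  This is what makes the suprema defining the constants finite.
\<close>

lemma lipschitz_gradient_on_compact:
  fixes f :: "'a::real_inner \<Rightarrow> real"
  assumes f: "has_loc_lipschitz_gradient f" and S: "compact S"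
  obtains K where "K-lipschitz_on S (gradient f)"
proof -
  have "local_lipschitz {0::real} S (\<lambda>_. gradient f)"
    unfolding local_lipschitz_def
  proof (intro ballI)
    fix x :: 'a and t :: real
    obtain r L where r: "r > 0" "L-lipschitz_on (ball x r) (gradient f)"
      using f unfolding has_loc_lipschitz_gradient_def by blast
    have "L-lipschitz_on (cball x (r / 2) \<inter> S) (gradient f)"
      using r by (intro lipschitz_on_subset[OF r(2)]) auto
    then show "\<exists>u>0. \<exists>L. \<forall>t\<in>cball t u \<inter> {0}. L-lipschitz_on (cball x u \<inter> S) (gradient f)"
      using r(1) half_gt_zero by blast
  qed
  then obtain K where "\<And>t. t \<in> {0::real} \<Longrightarrow> K-lipschitz_on S (gradient f)"
    by (rule local_lipschitz_compact_implies_lipschitz[OF _ S]) auto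
  then show thesis by (intro that) simp
qed

lemma norm_avg_le:
  fixes x :: "'d::finite \<Rightarrow> 'a::real_normed_vector"
  assumes "\<And>i. norm (x i) \<le> c"
  shows "norm (avg x) \<le> c"
proof -
  have "norm (\<Sum>i\<in>UNIV. x i) \<le> real CARD('d) * c"
    by (rule sum_norm_bound) (use assms in auto)
  then show ?thesis
    by (simp add: avg_def field_simps)
qed

lemma avg_diff: "avg x - avg y = avg (\<lambda>i. x i - y i)"
  by (simp add: avg_def sum_subtractf scaleR_diff_right)

lemma has_derivative_matrix_mult [derivative_intros]:
  fixes F :: "'a::real_normed_vector \<Rightarrow> real^'m^'n" and G :: "'a \<Rightarrow> real^'k^'m"
  assumes "(F has_derivative F') (at x within S)" "(G has_derivative G') (at x within S)"
  shows "((\<lambda>x. F x ** G x) has_derivative (\<lambda>h. F x ** G' h + F' h ** G x)) (at x within S)"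
  by (rule bounded_bilinear.FDERIV[OF bounded_bilinear_matrix_mult assms])

lemma has_derivative_transpose [derivative_intros]:
  fixes F :: "'a::real_normed_vector \<Rightarrow> real^'m^'n"
  assumes "(F has_derivative F') (at x within S)"
  shows "((\<lambda>x. transpose (F x)) has_derivative (\<lambda>h. transpose (F' h))) (at x within S)"
  by (rule bounded_linear.has_derivative[OF bounded_linear_transpose assms])

lemma GDERIV_b_pen: "GDERIV b_pen (X::real^'p^'n) :> X ** defect X"
proof -
  let ?D = "\<lambda>V. transpose X ** V + transpose V ** X"
  have d: "(defect has_derivative ?D) (at X)"
    unfolding defect_def[abs_def] by (auto intro!: derivative_eq_intros)
  have "((\<lambda>X. (1 / 4) * (defect X \<bullet> defect X)) has_derivative
      (\<lambda>V. (1 / 4) * (defect X \<bullet> ?D V + ?D V \<bullet> defect X))) (at X)"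
    by (intro has_derivative_mult_right has_derivative_inner d)
  moreover have "(1 / 4) * (defect X \<bullet> ?D V + ?D V \<bullet> defect X) = V \<bullet> (X ** defect X)" for V
  proof -
    have "(transpose V ** X) \<bullet> defect X = (transpose X ** V) \<bullet> defect X"
      using inner_transpose[of "transpose V ** X" "defect X"] by (simp add: matrix_transpose_mul)
    moreover have "(transpose X ** V) \<bullet> defect X = V \<bullet> (X ** defect X)"
      by (simp add: inner_matrix_mult_left)
    ultimately show ?thesis
      by (simp add: inner_add_left inner_add_right inner_commute)
  qed
  moreover have "b_pen = (\<lambda>X::real^'p^'n. (1 / 4) * (defect X \<bullet> defect X))"
    by (simp add: b_pen_def[abs_def] power2_norm_eq_inner defect_def)
  ultimately show ?thesis
    by (simp add: gderiv_def)
qed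

lemma gradient_b_pen [simp]: "gradient b_pen X = X ** defect X"
  by (rule gradient_eqI GDERIV_b_pen)+

text \<open>
  The right-hand side is the adjoint of the derivative of \<open>X \<mapsto> X X\<^sup>T X\<close>, applied to the
  gradient of \<open>g\<close>; the two terms with one transposed factor combine into the symmetric part.
\<close>

lemma GDERIV_comp_cube:
  fixes g :: "real^'p^'n \<Rightarrow> real"
  assumes "GDERIV g (cube X) :> N"
  shows "GDERIV (\<lambda>X. g (cube X)) X :>
           N ** (transpose X ** X) + 2 *\<^sub>R (X ** sym_part (transpose X ** N))"
proof -
  let ?C = "\<lambda>V. X ** transpose X ** V + (X ** transpose V + V ** transpose X) ** X"
  have "(cube has_derivative ?C) (at X)"
    unfolding cube_def[abs_def] by (auto intro!: derivative_eq_intros)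
  then have "((\<lambda>X. g (cube X)) has_derivative (\<lambda>V. ?C V \<bullet> N)) (at X)"
    using assms unfolding gderiv_def by (rule has_derivative_compose)
  moreover have "?C V \<bullet> N = V \<bullet> (N ** (transpose X ** X) + 2 *\<^sub>R (X ** sym_part (transpose X ** N)))" for V
  proof -
    have 1: "(X ** transpose X ** V) \<bullet> N = V \<bullet> (X ** (transpose X ** N))"
      by (simp add: inner_matrix_mult_left matrix_transpose_mul matrix_mul_assoc)
    have 2: "(V ** transpose X ** X) \<bullet> N = V \<bullet> (N ** (transpose X ** X))"
      by (simp add: inner_matrix_mult_right matrix_transpose_mul matrix_mul_assoc)
    have "(X ** transpose V ** X) \<bullet> N = transpose V \<bullet> (transpose X ** N ** transpose X)"
      by (simp only: inner_matrix_mult_right[of "X ** transpose V"] inner_matrix_mult_left[of X "transpose V"]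
          matrix_mul_assoc)
    also have "\<dots> = V \<bullet> transpose (transpose X ** N ** transpose X)"
      by (metis inner_transpose transpose_transpose)
    finally have 3: "(X ** transpose V ** X) \<bullet> N = V \<bullet> (X ** transpose (transpose X ** N))"
      by (simp add: matrix_transpose_mul)
    show ?thesis
      using 1 2 3 by (simp add: matrix_mult_simps inner_add_left inner_add_right sym_part_def)
  qed
  ultimately show ?thesis
    by (simp add: gderiv_def)
qed

lemma GDERIV_mult_const: "GDERIV g x :> N \<Longrightarrow> GDERIV (\<lambda>x. c * g x) x :> c *\<^sub>R N"
  unfolding gderiv_def by (auto intro!: derivative_eq_intros)

lemma G_loc_eq:
  "G_loc g X = (3 / 2) *\<^sub>R gradient g (cube X)
     - (1 / 2) *\<^sub>R (gradient g (cube X) ** (transpose X ** X))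
     - X ** sym_part (transpose X ** gradient g (cube X))"
  unfolding G_loc_def by (simp add: matrix_mult_simps algebra_simps)

lemma H_loc_eq: "H_loc g \<beta> X = G_loc g X + \<beta> *\<^sub>R (X ** defect X)"
  by (simp add: H_loc_def defect_def)

lemma avg_add: "avg (\<lambda>i. x i + y i) = avg x + avg y"
  by (simp add: avg_def sum.distrib scaleR_add_right)

lemma avg_const [simp]: "avg (\<lambda>i::'d::finite. c) = (c::'a::real_vector)"
  by (simp add: avg_def sum_constant_scaleR)

lemma linear_avg:
  assumes "linear T"
  shows "T (avg x) = avg (\<lambda>i. T (x i))"
  by (simp add: avg_def linear_scale[OF assms] linear_sum[OF assms])

lemma G_loc_stiefel:
  assumes "X \<in> stiefel"
  shows "G_loc g X = riem_grad g X"
proof -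
  have "transpose X ** X = mat 1"
    using assms by (simp add: stiefel_def)
  moreover from this have "cube X = X"
    by (simp add: cube_eq defect_def)
  ultimately show ?thesis
    by (simp add: G_loc_eq riem_grad_def flip: scaleR_left_diff_distrib)
qed

locale smooth_problem =
  fixes f :: "'d::finite \<Rightarrow> real^'p::finite^'n::finite \<Rightarrow> real"
  assumes smooth: "\<And>i. has_loc_lipschitz_gradient (f i)"
begin

lemma GDERIV_objective:
  "GDERIV (objective f) X :> avg (\<lambda>i. gradient (f i) X)"
proof -
  have "((\<lambda>X. (1 / real CARD('d)) * (\<Sum>i\<in>UNIV. f i X)) has_derivative
      (\<lambda>h. (1 / real CARD('d)) * (\<Sum>i\<in>UNIV. h \<bullet> gradient (f i) X))) (at X)"
    using GDERIV_gradient[OF smooth] unfolding gderiv_def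
    by (intro has_derivative_mult_right has_derivative_sum) auto
  then show ?thesis
    by (simp add: gderiv_def objective_def[abs_def] avg_def inner_sum_right)
qed

lemma gradient_objective:
  "gradient (objective f) X = avg (\<lambda>i. gradient (f i) X)"
  by (rule gradient_eqI GDERIV_objective)+

lemma smooth_objective:
  "has_loc_lipschitz_gradient (objective f)"
  unfolding has_loc_lipschitz_gradient_def
proof (intro conjI allI)
  show "\<exists>g. GDERIV (objective f) X :> g" for X
    using GDERIV_objective by blast
  fix X :: "real^'p^'n"
  have "\<exists>K. K-lipschitz_on (cball X 1) (gradient (f i))" for i
    by (rule lipschitz_gradient_on_compact[OF smooth compact_cball]) blast
  then obtain K where K: "\<And>i. (K i)-lipschitz_on (cball X 1) (gradient (f i))"
    by metis
  have "(Max (range K))-lipschitz_on (ball X 1) (gradient (objective f))"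
  proof (rule lipschitz_onI)
    show "0 \<le> Max (range K)"
      using order_trans[OF lipschitz_on_nonneg[OF K[of undefined]] Max_ge[of "range K"]] by simp
    fix Y Z assume YZ: "Y \<in> ball X 1" "Z \<in> ball X 1"
    have "norm (gradient (f i) Y - gradient (f i) Z) \<le> Max (range K) * norm (Y - Z)" for i
    proof -
      have "norm (gradient (f i) Y - gradient (f i) Z) \<le> K i * norm (Y - Z)"
        using lipschitz_onD[OF K[of i], of Y Z] YZ by (simp add: dist_norm)
      also have "\<dots> \<le> Max (range K) * norm (Y - Z)"
        by (intro mult_right_mono) auto
      finally show ?thesis .
    qed
    then show "dist (gradient (objective f) Y) (gradient (objective f) Z) \<le> Max (range K) * dist Y Z"
      unfolding gradient_objective dist_norm avg_diff by (rule norm_avg_le)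
  qed
  then show "\<exists>r>0. \<exists>L. L-lipschitz_on (ball X r) (gradient (objective f))"
    using zero_less_one by blast
qed

text \<open>
  \<open>H\<close> replaces \<open>\<nabla>f X\<close> in the gradient of \<open>h\<close> by \<open>\<nabla>f (X X\<^sup>T X)\<close>, so that an agent needs a
  single gradient evaluation per step. The second summand is the price.
\<close>

lemma GDERIV_h_fun:
  "GDERIV (h_fun f \<beta>) X :> H_loc (objective f) \<beta> X
    + (3 / 2) *\<^sub>R (gradient (objective f) X - gradient (objective f) (cube X))"
proof -
  note g = GDERIV_gradient[OF smooth_objective]
  have "GDERIV (\<lambda>X. 3 / 2 * objective f X - 1 / 2 * objective f (cube X) + \<beta> * b_pen X) X :>
     (3 / 2) *\<^sub>R gradient (objective f) X
     - (1 / 2) *\<^sub>R (gradient (objective f) (cube X) ** (transpose X ** X)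
         + 2 *\<^sub>R (X ** sym_part (transpose X ** gradient (objective f) (cube X))))
     + \<beta> *\<^sub>R (X ** defect X)"
    by (intro GDERIV_add GDERIV_diff GDERIV_mult_const GDERIV_b_pen GDERIV_comp_cube g)
  then show ?thesis
    unfolding h_fun_def[abs_def]
    by (rule GDERIV_subst) (simp add: H_loc_eq G_loc_eq algebra_simps)
qed

text \<open>
  \<open>G_loc\<close> depends linearly on the gradient, hence averaging over the agents commutes with it.
\<close>

lemma G_avg_eq:
  "G_avg f X = G_loc (objective f) X"
proof -
  let ?T = "\<lambda>N. (1 / 2) *\<^sub>R (N ** (3 *\<^sub>R mat 1 - transpose X ** X)) - X ** sym_part (transpose X ** N)"
  have "linear ?T"
    by (rule linearI) (simp_all add: matrix_mult_simps sym_part_add sym_part_scaleR algebra_simps)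
  from linear_avg[OF this, symmetric] show ?thesis
    unfolding G_avg_def G_loc_def gradient_objective .
qed

lemma H_avg_eq:
  "avg (\<lambda>i. H_loc (f i) \<beta> X) = H_loc (objective f) \<beta> X"
  using G_avg_eq[of X] by (simp add: H_loc_eq avg_add G_avg_def)

end

section \<open>The constants as bounds on the two regions\<close>

text \<open>
  The value of the constant never matters, only that one exists; hiding it makes the closure
  properties below compose without bookkeeping.
\<close>

definition has_lipschitz_on :: "'a::metric_space set \<Rightarrow> ('a \<Rightarrow> 'b::metric_space) \<Rightarrow> bool" where
  "has_lipschitz_on S F \<longleftrightarrow> (\<exists>K. K-lipschitz_on S F)"

lemma has_lipschitz_on_id: "has_lipschitz_on S (\<lambda>x. x)"
  unfolding has_lipschitz_on_def by (blast intro: lipschitz_on_id)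

lemma has_lipschitz_on_const: "has_lipschitz_on S (\<lambda>x. c)"
  unfolding has_lipschitz_on_def by (blast intro: lipschitz_on_constant)

lemma has_lipschitz_on_diff:
  fixes F G :: "'a::metric_space \<Rightarrow> 'b::real_normed_vector"
  shows "has_lipschitz_on S F \<Longrightarrow> has_lipschitz_on S G \<Longrightarrow> has_lipschitz_on S (\<lambda>x. F x - G x)"
  unfolding has_lipschitz_on_def by (blast intro: lipschitz_on_diff)

lemma has_lipschitz_on_compose:
  "has_lipschitz_on S F \<Longrightarrow> has_lipschitz_on (F ` S) G \<Longrightarrow> has_lipschitz_on S (\<lambda>x. G (F x))"
  unfolding has_lipschitz_on_def by (blast intro: lipschitz_on_compose2)

lemma has_lipschitz_on_linear:
  assumes "bounded_linear T" "has_lipschitz_on S F"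
  shows "has_lipschitz_on S (\<lambda>x. T (F x))"
proof -
  obtain K where K: "K-lipschitz_on (F ` S) T"
    by (rule bounded_linear.lipschitz_boundE[OF assms(1)])
  show ?thesis
    by (rule has_lipschitz_on_compose[OF assms(2)]) (use K in \<open>auto simp: has_lipschitz_on_def\<close>)
qed

lemma has_lipschitz_on_continuous: "has_lipschitz_on S F \<Longrightarrow> continuous_on S F"
  unfolding has_lipschitz_on_def using lipschitz_on_continuous_on by blast

lemma has_lipschitz_on_bounded:
  fixes F :: "'a::metric_space \<Rightarrow> 'b::real_normed_vector"
  assumes "has_lipschitz_on S F" "compact S"
  shows "\<exists>c. \<forall>x\<in>S. norm (F x) \<le> c"
proof -
  have "bounded (F ` S)"
    by (intro compact_imp_bounded compact_continuous_image has_lipschitz_on_continuous assms)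
  then show ?thesis
    by (simp add: bounded_iff)
qed

lemma has_lipschitz_on_matrix_mult:
  fixes F :: "'a::metric_space \<Rightarrow> real^'m^'n" and G :: "'a \<Rightarrow> real^'k^'m"
  assumes F: "has_lipschitz_on S F" and G: "has_lipschitz_on S G" and S: "compact S"
  shows "has_lipschitz_on S (\<lambda>x. F x ** G x)"
proof -
  obtain a b where ab: "\<And>x. x \<in> S \<Longrightarrow> norm (F x) \<le> a" "\<And>x. x \<in> S \<Longrightarrow> norm (G x) \<le> b"
    using has_lipschitz_on_bounded[OF F S] has_lipschitz_on_bounded[OF G S] by blast
  obtain K M where K: "K-lipschitz_on S F" and M: "M-lipschitz_on S G"
    using F G unfolding has_lipschitz_on_def by blast
  have "(\<bar>a\<bar> * M + K * \<bar>b\<bar>)-lipschitz_on S (\<lambda>x. F x ** G x)"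
  proof (rule lipschitz_onI)
    fix x y assume xy: "x \<in> S" "y \<in> S"
    have "F x ** G x - F y ** G y = F x ** (G x - G y) + (F x - F y) ** G y"
      by (simp add: matrix_mult_simps)
    also have "norm \<dots> \<le> \<bar>a\<bar> * (M * dist x y) + (K * dist x y) * \<bar>b\<bar>"
      using ab(1)[OF xy(1)] ab(2)[OF xy(2)] lipschitz_onD[OF K xy] lipschitz_onD[OF M xy]
      unfolding dist_norm by (intro norm_triangle_le add_mono norm_matrix_mult_le_of) auto
    finally show "dist (F x ** G x) (F y ** G y) \<le> (\<bar>a\<bar> * M + K * \<bar>b\<bar>) * dist x y"
      by (simp add: dist_norm algebra_simps)
  next
    show "0 \<le> \<bar>a\<bar> * M + K * \<bar>b\<bar>"
      using lipschitz_on_nonneg[OF K] lipschitz_on_nonneg[OF M] by simp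
  qed
  then show ?thesis
    unfolding has_lipschitz_on_def by blast
qed

lemma bounded_linear_sym_part: "bounded_linear (sym_part :: real^'p^'p \<Rightarrow> real^'p^'p)"
  by (rule bounded_linear_intro[where K = 1])
     (simp_all add: sym_part_add sym_part_scaleR norm_sym_part_le)

lemmas has_lipschitz_on_transpose = has_lipschitz_on_linear[OF bounded_linear_transpose]
lemmas has_lipschitz_on_sym_part = has_lipschitz_on_linear[OF bounded_linear_sym_part]
lemmas has_lipschitz_on_scaleR = has_lipschitz_on_linear[OF bounded_linear_scaleR_right]

lemmas has_lipschitz_on_intros =
  has_lipschitz_on_id has_lipschitz_on_const has_lipschitz_on_diff has_lipschitz_on_transpose
  has_lipschitz_on_sym_part has_lipschitz_on_scaleR has_lipschitz_on_matrix_mult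

lemma has_lipschitz_on_cube: "compact S \<Longrightarrow> has_lipschitz_on S cube"
  unfolding cube_def[abs_def] by (intro has_lipschitz_on_intros)

lemma has_lipschitz_on_gradient:
  "has_loc_lipschitz_gradient g \<Longrightarrow> compact S \<Longrightarrow> has_lipschitz_on S (gradient g)"
  unfolding has_lipschitz_on_def using lipschitz_gradient_on_compact by blast

lemma has_lipschitz_on_gradient_cube:
  assumes "has_loc_lipschitz_gradient g" "compact S"
  shows "has_lipschitz_on S (\<lambda>X. gradient g (cube X))"
proof (rule has_lipschitz_on_compose[OF has_lipschitz_on_cube[OF assms(2)]])
  have "compact (cube ` S)"
    by (intro compact_continuous_image has_lipschitz_on_continuous has_lipschitz_on_cube assms)
  then show "has_lipschitz_on (cube ` S) (gradient g)"
    by (rule has_lipschitz_on_gradient[OF assms(1)])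
qed

lemma has_lipschitz_on_G_loc:
  assumes "has_loc_lipschitz_gradient g" "compact S"
  shows "has_lipschitz_on S (G_loc g)"
  unfolding G_loc_def[abs_def]
  by (intro has_lipschitz_on_intros has_lipschitz_on_gradient_cube assms)

lemma has_lipschitz_on_penalty_gradient:
  "compact S \<Longrightarrow> has_lipschitz_on S (\<lambda>X. X ** defect X)"
  unfolding defect_def by (intro has_lipschitz_on_intros)

text \<open>
  Continuity of \<open>G\<close> on the whole space is needed at limit points.
\<close>

lemma continuous_on_UNIV_if_lipschitz_on_cballs:
  fixes F :: "'a::euclidean_space \<Rightarrow> 'b::metric_space"
  assumes "\<And>r. has_lipschitz_on (cball 0 r) F"
  shows "continuous_on UNIV F"
proof (rule continuous_at_imp_continuous_on, intro ballI)
  fix x :: 'a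
  have "continuous_on (ball 0 (norm x + 1)) F"
    by (rule continuous_on_subset[OF has_lipschitz_on_continuous[OF assms] ball_subset_cball])
  then show "isCont F x"
    by (simp add: continuous_on_eq_continuous_at)
qed

text \<open>
  All the constants are suprema over a point and, possibly, an agent. Finiteness of the set of
  agents turns bounds for each agent into a common one. For a supremum without agent, the index
  type is instantiated to a singleton.
\<close>

lemma le_Sup_family:
  fixes F :: "'d::finite \<Rightarrow> 'a \<Rightarrow> real"
  assumes "\<And>i. \<exists>c. \<forall>x\<in>S. F i x \<le> c" "x \<in> S"
  shows "F i x \<le> Sup {F i x | x i. x \<in> S}"
proof (rule cSup_upper)
  obtain c where c: "\<And>i x. x \<in> S \<Longrightarrow> F i x \<le> c i"
    using assms(1) by metis
  have "F i x \<le> Max (range c)" if "x \<in> S" for i x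
    by (rule order_trans[OF c[OF that] Max_ge]) auto
  then show "bdd_above {F i x | x i. x \<in> S}"
    by (intro bdd_aboveI[of _ "Max (range c)"]) auto
qed (use assms(2) in blast)

lemma quotient_le_lipschitz:
  assumes "K-lipschitz_on S F" "X \<in> S" "Y \<in> S"
  shows "norm (F X - F Y) / norm (X - Y) \<le> K"
  using lipschitz_onD[OF assms] lipschitz_on_nonneg[OF assms(1)]
  by (cases "X = Y") (auto simp: dist_norm field_simps)

lemma region_B_eq:
  fixes f :: "'d::finite \<Rightarrow> real^'p^'n \<Rightarrow> real"
  shows "region_B f = cball 0 (sqrt (7 * real CARD('d) * real CARD('p) / 6) + sqrt (real CARD('d)))"
  by (auto simp: region_B_def)

lemma compact_region_B: "compact (region_B f)" and convex_region_B: "convex (region_B f)"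
  by (simp_all add: region_B_eq)

text \<open>
  The radius of \<open>region_B\<close> is tailored to this: a block of the iterate is at distance at most
  \<open>\<surd>d\<close> from the mean, which lies in \<open>region_R\<close>.
\<close>

lemma region_B_near_region_R:
  fixes f :: "'d::finite \<Rightarrow> real^'p^'n \<Rightarrow> real"
  assumes "X \<in> region_R" "norm (Y - X) \<le> sqrt (real CARD('d))"
  shows "Y \<in> region_B f"
proof -
  have "sqrt (7 * real CARD('p) / 6) \<le> sqrt (7 * real CARD('d) * real CARD('p) / 6)"
    by (simp add: Suc_leI)
  then show ?thesis
    using norm_triangle_sub[of Y X] norm_region_R[OF assms(1)] assms(2)
    unfolding region_B_def mem_Collect_eq by linarith
qed

lemma region_R_subset_B: "X \<in> region_R \<Longrightarrow> X \<in> region_B f"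
  by (rule region_B_near_region_R) auto

text \<open>
  A witness that the quotients defining \<open>L_g\<close>, \<open>L_b\<close> and \<open>L_f\<close> range over nonempty sets, and
  that \<open>L_b\<close> is positive. Any matrix of norm \<open>1 / 2\<close> will do, since \<open>\<parallel>X X\<^sup>T X\<parallel> \<le> \<parallel>X\<parallel>\<^sup>3 < \<parallel>X\<parallel>\<close>.
\<close>

lemma exists_nonstationary_in_B:
  fixes f :: "'d::finite \<Rightarrow> real^'p^'n \<Rightarrow> real"
  shows "\<exists>X\<in>region_B f. X \<noteq> 0 \<and> X ** defect X \<noteq> 0"
proof -
  obtain X :: "real^'p^'n" where X: "norm X = 1 / 2"
    using vector_choose_size[of "1/2"] by auto
  have "norm (X ** (transpose X ** X)) \<le> norm X * (norm X * norm X)"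
    by (intro norm_matrix_mult_le_of) (auto intro: order_trans[OF norm_matrix_mult_le])
  then have "X ** (transpose X ** X) \<noteq> X"
    using X by auto
  then have "X ** defect X \<noteq> 0"
    by (simp add: defect_def matrix_mult_simps)
  moreover have "X \<in> region_B f"
  proof -
    have "1 \<le> sqrt (real CARD('d))"
      by (simp add: Suc_leI)
    moreover have "0 \<le> sqrt (7 * real CARD('d) * real CARD('p) / 6)"
      by simp
    ultimately show ?thesis
      using X unfolding region_B_def mem_Collect_eq by linarith
  qed
  moreover have "X \<noteq> 0"
    using X by auto
  ultimately show ?thesis
    by blast
qed

context smooth_problem
begin

lemma norm_G_loc_le_M_g: "X \<in> region_B f \<Longrightarrow> norm (G_loc (f i) X) \<le> M_g f"
  unfolding M_g_def
  by (rule le_Sup_family[where F = "\<lambda>i X. norm (G_loc (f i) X)"])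
     (rule has_lipschitz_on_bounded[OF has_lipschitz_on_G_loc[OF smooth compact_region_B] compact_region_B])

lemma norm_penalty_gradient_le_M_b: "X \<in> region_B f \<Longrightarrow> norm (X ** defect X) \<le> M_b f"
  unfolding M_b_def gradient_b_pen
  by (rule le_Sup_family[where F = "\<lambda>(_::unit) X. norm (X ** defect X)", simplified])
     (rule has_lipschitz_on_bounded[OF has_lipschitz_on_penalty_gradient[OF compact_region_B] compact_region_B])

lemma G_loc_lipschitz_B:
  assumes "X \<in> region_B f" "Y \<in> region_B f"
  shows "norm (G_loc (f i) X - G_loc (f i) Y) \<le> L_g f * norm (X - Y)"
proof (cases "X = Y")
  case False
  let ?S = "{(X, Y). X \<noteq> Y \<and> X \<in> region_B f \<and> Y \<in> region_B f}"
  let ?F = "\<lambda>i (X, Y). norm (G_loc (f i) X - G_loc (f i) Y) / norm (X - Y)"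
  have "\<exists>c. \<forall>z\<in>?S. ?F i z \<le> c" for i
    using has_lipschitz_on_G_loc[OF smooth[of i] compact_region_B[of f]]
    unfolding has_lipschitz_on_def by (force dest: quotient_le_lipschitz)
  then have "?F i (X, Y) \<le> Sup {?F i z | z i. z \<in> ?S}"
    by (rule le_Sup_family) (use assms False in auto)
  also have "{?F i z | z i. z \<in> ?S} = {norm (G_loc (f i) X - G_loc (f i) Y) / norm (X - Y) | X Y i.
                  X \<noteq> Y \<and> X \<in> region_B f \<and> Y \<in> region_B f}"
    by auto
  finally show ?thesis
    using False by (simp add: L_g_def pos_divide_le_eq)
qed simp

lemma penalty_gradient_lipschitz_B:
  assumes "X \<in> region_B f" "Y \<in> region_B f"
  shows "norm (X ** defect X - Y ** defect Y) \<le> L_b f * norm (X - Y)"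
proof (cases "X = Y")
  case False
  let ?S = "{(X, Y). X \<noteq> Y \<and> X \<in> region_B f \<and> Y \<in> region_B f}"
  let ?F = "\<lambda>(_::unit) (X, Y). norm (X ** defect X - Y ** defect Y) / norm (X - Y)"
  have "\<exists>c. \<forall>z\<in>?S. ?F u z \<le> c" for u
    using has_lipschitz_on_penalty_gradient[OF compact_region_B[of f]]
    unfolding has_lipschitz_on_def by (force dest: quotient_le_lipschitz)
  then have "?F () (X, Y) \<le> Sup {?F i z | z i. z \<in> ?S}"
    by (rule le_Sup_family) (use assms False in auto)
  also have "{?F i z | z i. z \<in> ?S} =
      {norm (gradient b_pen X - gradient b_pen Y) / norm (X - Y) | X Y.
                  X \<noteq> Y \<and> X \<in> region_B f \<and> Y \<in> region_B f}"
    by auto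
  finally show ?thesis
    using False by (simp add: L_b_def pos_divide_le_eq)
qed simp

text \<open>
  The supremum is finite because its denominator is the distance \<open>\<parallel>X X\<^sup>T X - X\<parallel>\<close> of the two
  points at which the gradient is evaluated; a Lipschitz constant on a compact set that contains
  both is an upper bound.
\<close>

lemma gradient_gap_le_L_f:
  assumes X: "X \<in> region_B f"
  shows "norm (gradient (objective f) X - gradient (objective f) (cube X)) \<le> L_f f * norm (X ** defect X)"
proof (cases "X = cube X")
  case True
  then show ?thesis
    by (simp add: cube_eq)
next
  case False
  have "compact (region_B f \<union> cube ` region_B f)"
    by (intro compact_Un compact_continuous_image has_lipschitz_on_continuous has_lipschitz_on_cube
        compact_region_B)
  then obtain K where K: "K-lipschitz_on (region_B f \<union> cube ` region_B f) (gradient (objective f))"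
    by (rule lipschitz_gradient_on_compact[OF smooth_objective])
  let ?F = "\<lambda>(_::unit) X. norm (gradient (objective f) X - gradient (objective f) (cube X)) / norm (X ** defect X)"
  let ?S = "{X. X \<in> region_B f \<and> X \<noteq> cube X}"
  have "?F u Y \<le> K" if "Y \<in> ?S" for u Y
    using quotient_le_lipschitz[OF K, of Y "cube Y"] that by (simp add: cube_eq norm_minus_commute)
  then have "?F () X \<le> Sup {?F i X | X i. X \<in> ?S}"
    by (intro le_Sup_family) (use X False in auto)
  also have "{?F i X | X i. X \<in> ?S} = {norm (gradient (objective f) X - gradient (objective f) (cube X))
                  / norm (X ** (transpose X ** X - mat 1)) | X.
                  X \<in> region_B f \<and> X \<noteq> cube X}"
    by (auto simp: defect_def)
  finally show ?thesis
    using False by (simp add: L_f_def pos_divide_le_eq cube_eq)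
qed

lemma norm_gradient_cube_le_C0:
  assumes X: "X \<in> region_R"
  shows "norm (gradient (objective f) (cube X)) \<le> C0 f"
proof -
  have "\<exists>c. \<forall>X\<in>region_R. norm (gradient (objective f) (cube X)) \<le> c"
    using has_lipschitz_on_bounded[OF has_lipschitz_on_gradient_cube[OF smooth_objective
          compact_region_B[of f]] compact_region_B[of f]] region_R_subset_B
    by metis
  then show ?thesis
    unfolding C0_def
    using le_Sup_family[where F = "\<lambda>(_::unit) X. norm (gradient (objective f) (cube X))", of region_R X] X
    by simp
qed

lemma zero_in_region_B: "0 \<in> region_B f"
  by (simp add: region_B_def)

lemma M_g_nonneg: "0 \<le> M_g f"
  by (rule order_trans[OF norm_ge_zero norm_G_loc_le_M_g[OF zero_in_region_B]])

lemma M_b_nonneg: "0 \<le> M_b f"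
  by (rule order_trans[OF norm_ge_zero norm_penalty_gradient_le_M_b[OF zero_in_region_B]])

lemma L_b_pos: "0 < L_b f" and L_g_nonneg: "0 \<le> L_g f" and L_f_nonneg: "0 \<le> L_f f"
proof -
  obtain X where X: "X \<in> region_B f" "X \<noteq> 0" "X ** defect X \<noteq> 0"
    using exists_nonstationary_in_B by blast
  have "0 < norm (X ** defect X)"
    using X by simp
  also have "\<dots> \<le> L_b f * norm X"
    using penalty_gradient_lipschitz_B[OF X(1) zero_in_region_B] by simp
  finally show "0 < L_b f"
    by (simp add: zero_less_mult_iff X)
  have "0 \<le> L_g f * norm X"
    using order_trans[OF norm_ge_zero G_loc_lipschitz_B[OF X(1) zero_in_region_B]] by simp
  then show "0 \<le> L_g f"
    using X by (simp add: zero_le_mult_iff)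
  have "0 \<le> L_f f * norm (X ** defect X)"
    using order_trans[OF norm_ge_zero gradient_gap_le_L_f[OF X(1)]] .
  then show "0 \<le> L_f f"
    using X by (simp add: zero_le_mult_iff)
qed

lemma H_loc_lipschitz_B:
  assumes "X \<in> region_B f" "Y \<in> region_B f" "0 \<le> \<beta>"
  shows "norm (H_loc (f i) \<beta> X - H_loc (f i) \<beta> Y) \<le> L_tot f \<beta> * norm (X - Y)"
proof -
  have "norm (H_loc (f i) \<beta> X - H_loc (f i) \<beta> Y)
      = norm ((G_loc (f i) X - G_loc (f i) Y) + \<beta> *\<^sub>R (X ** defect X - Y ** defect Y))"
    by (simp add: H_loc_eq algebra_simps)
  also have "\<dots> \<le> L_g f * norm (X - Y) + \<beta> * (L_b f * norm (X - Y))"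
    using assms by (intro norm_triangle_le add_mono G_loc_lipschitz_B)
      (auto intro!: mult_left_mono penalty_gradient_lipschitz_B)
  finally show ?thesis
    by (simp add: L_tot_def algebra_simps)
qed

lemma H_objective_lipschitz_B:
  assumes "X \<in> region_B f" "Y \<in> region_B f" "0 \<le> \<beta>"
  shows "norm (H_loc (objective f) \<beta> X - H_loc (objective f) \<beta> Y) \<le> L_tot f \<beta> * norm (X - Y)"
  unfolding H_avg_eq[symmetric] avg_diff by (intro norm_avg_le H_loc_lipschitz_B assms)

lemma norm_G_objective_le_M_g: "X \<in> region_B f \<Longrightarrow> norm (G_loc (objective f) X) \<le> M_g f"
  unfolding G_avg_eq[symmetric] G_avg_def by (intro norm_avg_le norm_G_loc_le_M_g)

lemma norm_H_loc_le:
  assumes "X \<in> region_B f" "0 \<le> \<beta>"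
  shows "norm (H_loc (f i) \<beta> X) \<le> M_g f + \<beta> * M_b f"
  unfolding H_loc_eq using assms
  by (intro norm_triangle_le add_mono norm_G_loc_le_M_g)
     (auto intro!: mult_left_mono norm_penalty_gradient_le_M_b)

end

section \<open>Stacked families and mixing\<close>

definition mix :: "real^'d^'d \<Rightarrow> ('d::finite \<Rightarrow> 'a::real_vector) \<Rightarrow> 'd \<Rightarrow> 'a" where
  "mix W Z i = (\<Sum>j\<in>UNIV. W $ i $ j *\<^sub>R Z j)"

text \<open>
  The distance of a family to its consensus, that is \<open>\<parallel>J Z - Z\<parallel>\<close> for the stacked matrix \<open>Z\<close>.
\<close>

definition disagreement :: "('d::finite \<Rightarrow> real^'p^'n) \<Rightarrow> real" where
  "disagreement Z = norm (stack (\<lambda>i. Z i - avg Z))"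

lemma sum_UNIV_prod: "(\<Sum>r\<in>UNIV. F r) = (\<Sum>i\<in>UNIV. \<Sum>a\<in>UNIV. F (i, a))"
  for F :: "'d::finite \<times> 'n::finite \<Rightarrow> 'b::comm_monoid_add"
  by (simp add: sum.cartesian_product flip: UNIV_Times_UNIV)

lemma inner_stack: "stack Y \<bullet> stack Z = (\<Sum>i\<in>UNIV. Y i \<bullet> Z i)"
  by (simp add: inner_vec_def stack_def sum_UNIV_prod)

lemma norm_stack: "(norm (stack Z))\<^sup>2 = (\<Sum>i\<in>UNIV. (norm (Z i))\<^sup>2)"
  by (simp add: power2_norm_eq_inner inner_stack)

lemma stack_add: "stack (\<lambda>i. Y i + Z i) = stack Y + stack Z"
  and stack_diff: "stack (\<lambda>i. Y i - Z i) = stack Y - stack Z"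
  and stack_scaleR: "stack (\<lambda>i. c *\<^sub>R Z i) = c *\<^sub>R stack Z"
  by (simp_all add: stack_def vec_eq_iff)

lemma norm_component_le_stack: "norm (Z i) \<le> norm (stack Z)"
proof (rule power2_le_imp_le)
  show "(norm (Z i))\<^sup>2 \<le> (norm (stack Z))\<^sup>2"
    unfolding norm_stack by (rule member_le_sum) auto
qed simp

lemma norm_stack_mono:
  assumes "\<And>i. norm (Y i) \<le> c * norm (Z i)" "0 \<le> c"
  shows "norm (stack Y) \<le> c * norm (stack Z)"
proof (rule power2_le_imp_le)
  have "(norm (stack Y))\<^sup>2 \<le> (\<Sum>i\<in>UNIV. (c * norm (Z i))\<^sup>2)"
    unfolding norm_stack by (intro sum_mono power_mono assms) auto
  also have "\<dots> = (c * norm (stack Z))\<^sup>2"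
    by (simp add: power_mult_distrib norm_stack sum_distrib_left)
  finally show "(norm (stack Y))\<^sup>2 \<le> (c * norm (stack Z))\<^sup>2" .
qed (use assms in simp)

lemma norm_stack_const:
  "norm (stack (\<lambda>i::'d::finite. (A::real^'p^'n))) = sqrt (real CARD('d)) * norm A"
  by (rule power2_eq_imp_eq) (simp_all add: norm_stack power_mult_distrib)

lemma sum_eq_scaleR_avg: "(\<Sum>i\<in>UNIV. Z i) = real CARD('d) *\<^sub>R avg (Z :: 'd::finite \<Rightarrow> 'a::real_vector)"
  by (simp add: avg_def)

lemma avg_minus_avg: "avg (\<lambda>i. Z i - avg Z) = 0"
  by (simp flip: avg_diff)

text \<open>
  Consensual families and families of mean zero are orthogonal.
\<close>

lemma norm_sq_stack_split:
  fixes Z :: "'d::finite \<Rightarrow> real^'p^'n"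
  assumes "avg Y = 0"
  shows "(norm (stack (\<lambda>i. A + Y i)))\<^sup>2 = real CARD('d) * (norm A)\<^sup>2 + (norm (stack (Y :: 'd \<Rightarrow> real^'p^'n)))\<^sup>2"
proof -
  have "stack (\<lambda>i::'d. A) \<bullet> stack Y = 0"
    using sum_eq_scaleR_avg[of Y] assms by (simp add: inner_stack flip: inner_sum_right)
  then have "(norm (stack (\<lambda>i. A + Y i)))\<^sup>2 = (norm (stack (\<lambda>i::'d. A)))\<^sup>2 + (norm (stack Y))\<^sup>2"
    by (simp add: stack_add power2_norm_eq_inner inner_add_left inner_add_right inner_commute)
  then show ?thesis
    by (simp add: norm_stack_const power_mult_distrib)
qed

lemma norm_sq_stack_eq:
  fixes Z :: "'d::finite \<Rightarrow> real^'p^'n"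
  shows "(norm (stack Z))\<^sup>2 = real CARD('d) * (norm (avg Z))\<^sup>2 + (disagreement Z)\<^sup>2"
  using norm_sq_stack_split[OF avg_minus_avg[of Z], of "avg Z"] by (simp add: disagreement_def)

lemma disagreement_le_norm: "disagreement Z \<le> norm (stack Z)"
  by (rule power2_le_imp_le) (simp_all add: norm_sq_stack_eq)

lemma norm_avg_le_norm_stack:
  fixes Z :: "'d::finite \<Rightarrow> real^'p^'n"
  shows "norm (avg Z) \<le> norm (stack Z) / sqrt (real CARD('d))"
proof (rule power2_le_imp_le)
  have "real CARD('d) * (norm (avg Z))\<^sup>2 \<le> (norm (stack Z))\<^sup>2"
    by (simp add: norm_sq_stack_eq)
  then show "(norm (avg Z))\<^sup>2 \<le> (norm (stack Z) / sqrt (real CARD('d)))\<^sup>2"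
    by (simp add: power_divide field_simps)
qed simp

lemma norm_stack_le:
  fixes Z :: "'d::finite \<Rightarrow> real^'p^'n"
  shows "norm (stack Z) \<le> disagreement Z + sqrt (real CARD('d)) * norm (avg Z)"
proof -
  have "norm (stack Z) = norm (stack (\<lambda>i. (Z i - avg Z) + avg Z))"
    by simp
  also have "\<dots> \<le> disagreement Z + norm (stack (\<lambda>i::'d. avg Z))"
    unfolding disagreement_def stack_add[of "\<lambda>i. Z i - avg Z"] by (rule norm_triangle_ineq)
  finally show ?thesis
    by (simp add: norm_stack_const)
qed

lemma J_mat_stack: "J_mat ** stack Z = stack (\<lambda>i. avg Z)"
  by (simp add: vec_eq_iff matrix_matrix_mult_def J_mat_def kron_def avg_matrix_def mat_def stack_def
      sum_UNIV_prod avg_def sum_component sum_distrib_left if_distrib if_distribR cong: if_cong)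

lemma norm_J_mat_stack: "norm (J_mat ** stack Z - stack Z) = disagreement Z"
  by (simp add: J_mat_stack disagreement_def stack_diff norm_minus_commute)

lemma block_mean_stack: "block_mean (stack Z) = avg Z"
  by (simp add: vec_eq_iff matrix_matrix_mult_def block_mean_def kron_vec_def mat_def stack_def
      transpose_def sum_UNIV_prod avg_def sum_component if_distrib if_distribR cong: if_cong)

lemma replicate_blocks_eq: "replicate_blocks A = stack (\<lambda>i. A)"
  by (simp add: vec_eq_iff matrix_matrix_mult_def replicate_blocks_def kron_vec_def mat_def stack_def
      if_distrib if_distribR cong: if_cong)

lemma exists_stack: "\<exists>Z. S = stack Z"
proof
  show "S = stack (\<lambda>i. \<chi> a. S $ (i, a))"
    by (simp add: stack_def vec_eq_iff)
qed

lemma mix_diff: "mix W (\<lambda>i. Y i - Z i) i = mix W Y i - mix W Z i"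
  by (simp add: mix_def scaleR_diff_right sum_subtractf)

locale mixing_network =
  fixes E :: "('d::finite \<times> 'd) set" and W :: "real^'d^'d"
  assumes mixing: "mixing_matrix E W"
begin

abbreviation "\<theta> \<equiv> mixing_rate W"

lemma mixing_rate_nonneg: "0 \<le> \<theta>"
  unfolding mixing_rate_def spectral_norm_def by (rule onorm_pos_le) (rule matrix_vector_mul_bounded_linear)

lemma mixing_rate_less_1: "\<theta> < 1"
  using mixing by (simp add: mixing_matrix_def)

lemma row_sum: "(\<Sum>j\<in>UNIV. W $ i $ j) = 1"
proof -
  have "(W *v 1) $ i = 1"
    using mixing by (simp add: mixing_matrix_def)
  then show ?thesis
    by (simp add: matrix_vector_mult_def)
qed

lemma column_sum: "(\<Sum>i\<in>UNIV. W $ i $ j) = 1"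
proof -
  have "(transpose W *v 1) $ j = 1"
    using mixing unfolding mixing_matrix_def by (metis one_index)
  then show ?thesis
    by (simp only: matrix_vector_mult_def transpose_def) simp
qed

lemma mix_const: "mix W (\<lambda>j. A) i = A"
  by (simp add: mix_def row_sum flip: scaleR_sum_left)

lemma avg_mix: "avg (mix W Z) = avg Z"
proof -
  have "(\<Sum>i\<in>UNIV. mix W Z i) = (\<Sum>j\<in>UNIV. \<Sum>i\<in>UNIV. W $ i $ j *\<^sub>R Z j)"
    unfolding mix_def by (rule sum.swap)
  also have "\<dots> = (\<Sum>j\<in>UNIV. Z j)"
    by (simp add: column_sum flip: scaleR_sum_left)
  finally show ?thesis
    by (simp add: avg_def)
qed

text \<open>
  On mean-zero families, \<open>W\<close> and \<open>W\<close> minus the averaging matrix agree. The definition of the mixing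
  rate concerns vectors indexed by the agents; it is applied to each matrix entry separately.
\<close>

lemma norm_mix_le:
  fixes Z :: "'d \<Rightarrow> real^'p^'n"
  assumes "avg Z = 0"
  shows "norm (stack (mix W Z)) \<le> \<theta> * norm (stack Z)"
proof (rule power2_le_imp_le)
  define z :: "'n \<Rightarrow> 'p \<Rightarrow> real^'d" where "z a b = (\<chi> j. Z j $ a $ b)" for a b
  have sq: "(norm (stack Y))\<^sup>2 = (\<Sum>a\<in>UNIV. \<Sum>b\<in>UNIV. (norm (\<chi> j. Y j $ a $ b))\<^sup>2)"
    for Y :: "'d \<Rightarrow> real^'p^'n"
  proof -
    have "(norm (stack Y))\<^sup>2 = (\<Sum>i\<in>UNIV. \<Sum>a\<in>UNIV. \<Sum>b\<in>UNIV. (Y i $ a $ b)\<^sup>2)"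
      unfolding norm_stack unfolding power2_norm_eq_inner frobenius_inner by (simp add: power2_eq_square)
    also have "\<dots> = (\<Sum>a\<in>UNIV. \<Sum>i\<in>UNIV. \<Sum>b\<in>UNIV. (Y i $ a $ b)\<^sup>2)"
      by (rule sum.swap)
    also have "\<dots> = (\<Sum>a\<in>UNIV. \<Sum>b\<in>UNIV. \<Sum>i\<in>UNIV. (Y i $ a $ b)\<^sup>2)"
      by (intro sum.cong refl sum.swap)
    finally show ?thesis
      unfolding power2_norm_eq_inner inner_vec_def by (simp add: power2_eq_square)
  qed
  have "sum Z UNIV = 0"
    using sum_eq_scaleR_avg[of Z] assms by simp
  then have "(\<Sum>j\<in>UNIV. Z j $ a $ b) = 0" for a b
    by (metis (no_types) sum_component zero_index)
  then have "(\<chi> i. mix W Z i $ a $ b) = (W - avg_matrix) *v z a b" for a b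
    by (simp add: vec_eq_iff mix_def z_def matrix_vector_mult_def avg_matrix_def
        left_diff_distrib sum_subtractf flip: sum_divide_distrib)
  moreover have "norm ((W - avg_matrix) *v z a b) \<le> \<theta> * norm (z a b)" for a b
    unfolding mixing_rate_def spectral_norm_def by (rule onorm) (rule matrix_vector_mul_bounded_linear)
  ultimately have "(norm (stack (mix W Z)))\<^sup>2 \<le> (\<Sum>a\<in>UNIV. \<Sum>b\<in>UNIV. (\<theta> * norm (z a b))\<^sup>2)"
    unfolding sq by (intro sum_mono power_mono) auto
  also have "\<dots> = (\<theta> * norm (stack Z))\<^sup>2"
    unfolding power_mult_distrib sq z_def by (simp add: sum_distrib_left)
  finally show "(norm (stack (mix W Z)))\<^sup>2 \<le> (\<theta> * norm (stack Z))\<^sup>2" .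
qed (use mixing_rate_nonneg in simp)

lemma disagreement_mix_le:
  fixes Z :: "'d \<Rightarrow> real^'p^'n"
  shows "disagreement (mix W Z) \<le> \<theta> * disagreement Z"
proof -
  have "mix W (\<lambda>i. Z i - avg Z) = (\<lambda>i. mix W Z i - avg Z)"
    by (rule ext) (simp add: mix_diff mix_const)
  then have "disagreement (mix W Z) = norm (stack (mix W (\<lambda>i. Z i - avg Z)))"
    unfolding disagreement_def avg_mix by simp
  also have "\<dots> \<le> \<theta> * disagreement Z"
    unfolding disagreement_def by (intro norm_mix_le avg_minus_avg)
  finally show ?thesis .
qed

end

lemma disagreement_add_le: "disagreement (\<lambda>i. Y i + Z i) \<le> disagreement Y + disagreement Z"
proof -
  have "disagreement (\<lambda>i. Y i + Z i) = norm (stack (\<lambda>i. (Y i - avg Y) + (Z i - avg Z)))"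
    by (simp add: disagreement_def avg_add algebra_simps)
  then show ?thesis
    unfolding stack_add by (simp add: disagreement_def norm_triangle_ineq)
qed

lemma disagreement_scaleR: "disagreement (\<lambda>i. c *\<^sub>R Z i) = \<bar>c\<bar> * disagreement Z"
proof -
  have "avg (\<lambda>i. c *\<^sub>R Z i) = c *\<^sub>R avg Z"
    by (simp add: avg_def scaleR_sum_right mult_ac)
  then have "disagreement (\<lambda>i. c *\<^sub>R Z i) = norm (c *\<^sub>R stack (\<lambda>i. Z i - avg Z))"
    by (simp add: disagreement_def scaleR_diff_right flip: stack_scaleR)
  then show ?thesis
    by (simp add: disagreement_def)
qed

section \<open>Invariance of the region around the Stiefel manifold\<close>

lemma defect_diff:
  "defect (Y - \<eta> *\<^sub>R S) = defect Y - \<eta> *\<^sub>R (transpose Y ** S + transpose (transpose Y ** S))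
     + \<eta>\<^sup>2 *\<^sub>R (transpose S ** (S::real^'p^'n))"
  unfolding defect_def
  by (simp add: matrix_mult_simps transpose_simps matrix_transpose_mul power2_eq_square algebra_simps)

text \<open>
  Along a pure penalty step everything is a polynomial in \<open>defect X\<close>; its linear coefficient
  \<open>1 - 2 a\<close> is the source of the contraction.
\<close>

lemma defect_penalty_step:
  fixes X :: "real^'p^'n"
  defines "E \<equiv> defect X"
  shows "defect (X - a *\<^sub>R (X ** E)) = (1 - 2 * a) *\<^sub>R E + (a\<^sup>2 - 2 * a) *\<^sub>R (E ** E) + a\<^sup>2 *\<^sub>R (E ** E ** E)"
proof -
  have XE: "transpose X ** (X ** E) = E + E ** E"
    by (simp add: matrix_mul_assoc gram_eq matrix_mult_simps E_def)
  have "transpose (transpose X ** (X ** E)) = transpose (E + E ** E)"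
    unfolding XE ..
  moreover have "transpose E = E"
    by (simp add: E_def)
  ultimately have EX: "transpose (X ** E) ** X = E + E ** E"
    by (simp add: matrix_transpose_mul transpose_simps matrix_mul_assoc)
  have "transpose (X ** E) ** (X ** E) = E ** (E + E ** E)"
    using XE \<open>transpose E = E\<close> by (simp add: matrix_transpose_mul flip: matrix_mul_assoc)
  with XE \<open>transpose (transpose X ** (X ** E)) = _\<close> \<open>transpose E = E\<close>
  have "defect (X - a *\<^sub>R (X ** E)) = E - a *\<^sub>R ((E + E ** E) + (E + E ** E)) + a\<^sup>2 *\<^sub>R (E ** E + E ** E ** E)"
    by (simp add: defect_diff E_def matrix_mult_simps transpose_simps matrix_transpose_mul matrix_mul_assoc)
  then show ?thesis
    by (simp add: vec_eq_iff algebra_simps)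
qed

text \<open>
  The matrix \<open>S\<close> stands for \<open>G\<close> plus the tracking error. With \<open>a = \<eta> \<beta>\<close>, the penalty part of the
  step reduces the bound \<open>1 / 6\<close> on the defect by about \<open>a / 4\<close>, whereas \<open>S\<close> adds at most a
  constant times \<open>\<eta> (1 + M)\<close>; the lower bound on \<open>\<beta>\<close> makes the former dominate.
\<close>

lemma region_R_step:
  fixes X :: "real^'p^'n"
  assumes X: "X \<in> region_R" and S: "norm S \<le> 1 + M" and M: "0 \<le> M"
    and beta: "72 * (4 + 3 * M) / 5 < \<beta>"
    and eta: "0 < \<eta>" "\<eta> < 216 / (49 * \<beta>\<^sup>2)" "\<eta> < 1 / (18 * (4 + 3 * M))"
  shows "X - \<eta> *\<^sub>R (S + \<beta> *\<^sub>R (X ** defect X)) \<in> region_R"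
proof -
  define E where "E = defect X"
  define a where "a = \<eta> * \<beta>"
  define Y where "Y = X - a *\<^sub>R (X ** E)"
  have E: "norm E \<le> 1 / 6"
    using X by (simp add: E_def region_R_iff)
  \<comment> \<open>From \<open>72 * 4 / 5 = 57.6\<close>; with \<open>\<eta> \<beta>\<^sup>2 < 216 / 49\<close> it yields \<open>a < 0.08\<close>.\<close>
  have \<beta>: "57 < \<beta>"
    using beta M by simp
  have "a * (49 * \<beta>) < 216"
    using eta(2) \<beta> by (simp add: a_def field_simps power2_eq_square)
  moreover have a0: "0 \<le> a"
    using eta(1) \<beta> by (simp add: a_def)
  moreover have "a * (49 * 57) \<le> a * (49 * \<beta>)"
    using a0 \<beta> by (intro mult_left_mono) auto
  ultimately have a: "0 \<le> a" "a \<le> 1 / 12"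
    by linarith+
  have a2: "a\<^sup>2 \<le> a / 12"
    using mult_left_mono[OF a(2) a(1)] by (simp add: power2_eq_square)
  have EE: "norm (E ** E) \<le> 1 / 6 * (1 / 6)"
    by (intro norm_matrix_mult_le_of E)
  then have EEE: "norm (E ** E ** E) \<le> 1 / 6 * (1 / 6) * (1 / 6)"
    by (intro norm_matrix_mult_le_of E)
  have "norm (defect Y) \<le> \<bar>1 - 2 * a\<bar> * norm E + \<bar>a\<^sup>2 - 2 * a\<bar> * norm (E ** E) + \<bar>a\<^sup>2\<bar> * norm (E ** E ** E)"
    unfolding Y_def E_def defect_penalty_step by (intro norm_triangle_le add_mono) auto
  also have "\<dots> \<le> (1 - 2 * a) * (1 / 6) + (2 * a) * (1 / 6 * (1 / 6)) + a / 12 * (1 / 6 * (1 / 6) * (1 / 6))"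
    using a a2 E EE EEE by (intro add_mono mult_mono) auto
  finally have defY: "norm (defect Y) \<le> 1 / 6 - 27 / 100 * a"
    using a by argo
  have XS: "norm (transpose X ** S) \<le> 13 / 12 * (1 + M)"
    using norm_transpose_mult_region_R[OF X, of S] S by simp
  have "transpose Y ** S = transpose X ** S - a *\<^sub>R (E ** (transpose X ** S))"
    by (simp add: Y_def transpose_simps matrix_mult_simps matrix_transpose_mul matrix_mul_assoc E_def)
  also have "norm \<dots> \<le> 13 / 12 * (1 + M) + a * (1 / 6 * (13 / 12 * (1 + M)))"
    using XS a norm_matrix_mult_le_of[OF E XS]
    by (intro order_trans[OF norm_triangle_ineq4] add_mono) (simp_all only: norm_scaleR abs_of_nonneg mult_left_mono)
  also have "\<dots> \<le> 13 / 12 * (1 + M) + 1 / 12 * (1 / 6 * (13 / 12 * (1 + M)))"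
    using a M by (intro add_left_mono mult_right_mono) auto
  finally have YS: "norm (transpose Y ** S) \<le> 11 / 10 * (1 + M)"
    using M by simp
  have SS: "norm (transpose S ** S) \<le> (1 + M) * (1 + M)"
    using S by (intro norm_matrix_mult_le_of) auto
  have "\<eta> * (1 + M) \<le> 1"
    using eta(1,3) M by (simp add: field_simps)
  then have etaM: "\<eta>\<^sup>2 * ((1 + M) * (1 + M)) \<le> \<eta> * (1 + M)"
    using mult_left_mono[of "\<eta> * (1 + M)" 1 "\<eta> * (1 + M)"] eta(1) M
    by (simp add: power2_eq_square mult_ac)
  have "X - \<eta> *\<^sub>R (S + \<beta> *\<^sub>R (X ** defect X)) = Y - \<eta> *\<^sub>R S"
    by (simp add: Y_def a_def E_def algebra_simps)
  also have "norm (defect (Y - \<eta> *\<^sub>R S)) \<le> norm (defect Y)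
      + \<eta> * (norm (transpose Y ** S) + norm (transpose Y ** S)) + \<eta>\<^sup>2 * norm (transpose S ** S)"
    unfolding defect_diff using eta(1)
    by (intro norm_triangle_le add_mono order_trans[OF norm_triangle_ineq4])
       (auto intro!: mult_left_mono intro: order_trans[OF norm_triangle_ineq] simp del: transpose_transpose)
  also have "\<dots> \<le> (1 / 6 - 27 / 100 * a) + \<eta> * (11 / 10 * (1 + M) + 11 / 10 * (1 + M)) + \<eta>\<^sup>2 * ((1 + M) * (1 + M))"
    using defY YS SS eta(1) by (intro add_mono mult_left_mono) auto
  also have "\<dots> \<le> 1 / 6 - 27 / 100 * a + 16 / 5 * (\<eta> * (1 + M))"
    using etaM by (simp add: algebra_simps)
  also have "\<dots> \<le> 1 / 6"
  proof -
    have "\<eta> * (40 * (1 + M)) \<le> \<eta> * \<beta>"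
      using beta M eta(1) by (intro mult_left_mono) auto
    then show ?thesis
      using a(1) by (simp add: a_def algebra_simps)
  qed
  finally show ?thesis
    by (simp add: region_R_iff)
qed

section \<open>Descent of the penalised objective\<close>

text \<open>
  The linear terms in the defect cancel: this is the reason for the form of \<open>G\<close>, and it makes \<open>G\<close>
  and the penalty gradient orthogonal up to second order.
\<close>

lemma inner_G_loc_penalty_gradient:
  "G_loc g X \<bullet> (X ** defect X)
     = - (3 / 2) * ((transpose X ** gradient g (cube X)) \<bullet> (defect X ** defect X))"
proof -
  define E where "E = defect X"
  define N where "N = gradient g (cube X)"
  define B where "B = transpose X ** N"
  have tE: "transpose E = E"
    by (simp add: E_def)
  have gram: "transpose X ** X = mat 1 + E"
    by (simp add: E_def gram_eq)
  have three: "3 *\<^sub>R mat 1 - (mat 1 + E) = 2 *\<^sub>R mat 1 - E"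
    by (simp add: vec_eq_iff mat_def)
  have "(N ** (2 *\<^sub>R mat 1 - E)) \<bullet> (X ** E) = (X ** E) \<bullet> (N ** (2 *\<^sub>R mat 1 - E))"
    by (rule inner_commute)
  also have "\<dots> = E \<bullet> (B ** (2 *\<^sub>R mat 1 - E))"
    by (simp add: inner_matrix_mult_left B_def matrix_mul_assoc)
  also have "\<dots> = B \<bullet> (E ** transpose (2 *\<^sub>R mat 1 - E))"
    by (metis inner_matrix_mult_right inner_commute)
  also have "\<dots> = 2 * (B \<bullet> E) - B \<bullet> (E ** E)"
    by (simp add: transpose_simps tE matrix_mult_simps inner_diff_right)
  finally have 1: "(N ** (2 *\<^sub>R mat 1 - E)) \<bullet> (X ** E) = 2 * (B \<bullet> E) - B \<bullet> (E ** E)" .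
  have "(X ** sym_part B) \<bullet> (X ** E) = sym_part B \<bullet> (E + E ** E)"
    by (simp add: inner_matrix_mult_left matrix_mul_assoc gram matrix_mult_simps)
  also have "\<dots> = B \<bullet> (E + E ** E)"
    by (rule inner_sym_part) (simp add: transpose_simps matrix_transpose_mul tE)
  finally have 2: "(X ** sym_part B) \<bullet> (X ** E) = B \<bullet> E + B \<bullet> (E ** E)"
    by (simp add: inner_add_right)
  have "G_loc g X \<bullet> (X ** E) = (1 / 2) * (2 * (B \<bullet> E) - B \<bullet> (E ** E)) - (B \<bullet> E + B \<bullet> (E ** E))"
    unfolding G_loc_def gram three using 1 2
    by (simp add: inner_diff_left flip: N_def B_def)
  then have "G_loc g X \<bullet> (X ** E) = - (3 / 2) * (B \<bullet> (E ** E))"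
    by (simp add: field_simps)
  then show ?thesis
    unfolding E_def N_def B_def .
qed

context smooth_problem
begin

text \<open>
  Expand the square. The mixed term is at least \<open>- (13 / 4) C0 \<beta> \<parallel>E\<parallel>\<^sup>2\<close> for the defect \<open>E\<close>, by
  near-orthogonality, and the square of the penalty gradient gives at least
  \<open>(5 / 6) \<beta>\<^sup>2 \<parallel>E\<parallel>\<^sup>2\<close>. The condition \<open>\<beta> > (6 + 21 C0) / 5\<close> leaves \<open>\<beta> \<parallel>E\<parallel>\<^sup>2\<close>.
\<close>

lemma norm_sq_H_lower_bound:
  assumes X: "X \<in> region_R" and beta: "(6 + 21 * C0 f) / 5 < \<beta>" "0 < \<beta>"
  shows "(norm (G_loc (objective f) X))\<^sup>2 + \<beta> * (norm (defect X))\<^sup>2 \<le> (norm (H_loc (objective f) \<beta> X))\<^sup>2"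
proof -
  define E where "E = defect X"
  define G where "G = G_loc (objective f) X"
  define N where "N = gradient (objective f) (cube X)"
  have C0: "norm N \<le> C0 f"
    unfolding N_def by (rule norm_gradient_cube_le_C0[OF X])
  then have C0': "0 \<le> C0 f"
    by (rule order_trans[OF norm_ge_zero])
  have "(transpose X ** N) \<bullet> (E ** E) \<le> norm (transpose X ** N) * norm (E ** E)"
    by (rule norm_cauchy_schwarz)
  also have "\<dots> \<le> (13 / 12 * C0 f) * (norm E * norm E)"
    using norm_transpose_mult_region_R[OF X, of N] C0 C0' by (intro mult_mono norm_matrix_mult_le) auto
  finally have cross: "- (3 / 2) * (13 / 12 * C0 f * (norm E)\<^sup>2) \<le> G \<bullet> (X ** E)"
    unfolding G_def E_def inner_G_loc_penalty_gradient by (simp add: N_def power2_eq_square)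
  have "(5 * \<beta> - 6 - 21 * C0 f) * (norm E)\<^sup>2 \<ge> 0"
    using beta by (intro mult_nonneg_nonneg) auto
  moreover have "0 \<le> C0 f * (norm E)\<^sup>2"
    using C0' by simp
  ultimately have "(norm E)\<^sup>2 \<le> \<beta> * (5 / 6 * (norm E)\<^sup>2) + 2 * (- (3 / 2) * (13 / 12 * C0 f * (norm E)\<^sup>2))"
    by (simp add: algebra_simps)
  also have "\<dots> \<le> \<beta> * (norm (X ** E))\<^sup>2 + 2 * (G \<bullet> (X ** E))"
    using cross norm_sq_mult_region_R(2)[OF X, of E] beta
    by (intro add_mono mult_left_mono) auto
  finally have "\<beta> * (norm E)\<^sup>2 \<le> \<beta> * (\<beta> * (norm (X ** E))\<^sup>2 + 2 * (G \<bullet> (X ** E)))"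
    using beta(2) by (intro mult_left_mono) auto
  moreover have "(norm (H_loc (objective f) \<beta> X))\<^sup>2
      = (norm G)\<^sup>2 + \<beta> * (\<beta> * (norm (X ** E))\<^sup>2 + 2 * (G \<bullet> (X ** E)))"
    unfolding H_loc_eq power2_norm_eq_inner
    by (simp add: inner_add_left inner_add_right inner_commute algebra_simps flip: G_def E_def)
  ultimately show ?thesis
    by (simp add: G_def E_def)
qed

text \<open>
  A descent lemma for \<open>h\<close>, whose gradient is \<open>H\<close> plus the gap between two gradients of \<open>f\<close>. A
  Lipschitz constant of the gap is not among the constants, so the gap is bounded pointwise on
  the segment by \<open>L_f\<close> times the penalty gradient, whose growth along the segment is governed by
  \<open>L_b\<close>. Instead of integrating, the proof shows that \<open>h\<close> minus the claimed quadratic bound is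
  nonincreasing along the segment.
\<close>

lemma h_fun_segment_bound:
  assumes X: "X \<in> region_B f" and XV: "X + V \<in> region_B f" and beta: "0 \<le> \<beta>"
  shows "h_fun f \<beta> (X + V) \<le> h_fun f \<beta> X + H_loc (objective f) \<beta> X \<bullet> V
      + 3 / 2 * L_f f * norm (X ** defect X) * norm V
      + (L_tot f \<beta> / 2 + 3 / 4 * L_f f * L_b f) * (norm V)\<^sup>2"
proof -
  let ?e = "\<lambda>Y. gradient (objective f) Y - gradient (objective f) (cube Y)"
  let ?H = "H_loc (objective f) \<beta>"
  define A where "A = ?H X \<bullet> V + 3 / 2 * L_f f * norm (X ** defect X) * norm V"
  define B where "B = L_tot f \<beta> / 2 + 3 / 4 * L_f f * L_b f"
  define \<psi> where "\<psi> t = h_fun f \<beta> (X + t *\<^sub>R V) - (A * t + B * (norm V)\<^sup>2 * t\<^sup>2)" for t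
  define \<psi>' where "\<psi>' t = (?H (X + t *\<^sub>R V) + (3 / 2) *\<^sub>R ?e (X + t *\<^sub>R V)) \<bullet> V
      - (A + B * (norm V)\<^sup>2 * (2 * t))" for t
  have deriv: "(\<psi> has_real_derivative \<psi>' t) (at t)" for t
  proof -
    have "((\<lambda>t. X + t *\<^sub>R V) has_derivative (\<lambda>s. s *\<^sub>R V)) (at t)"
      by (auto intro!: derivative_eq_intros)
    from has_derivative_compose[OF this GDERIV_h_fun[unfolded gderiv_def]]
    have "((\<lambda>t. h_fun f \<beta> (X + t *\<^sub>R V)) has_real_derivative
        (?H (X + t *\<^sub>R V) + (3 / 2) *\<^sub>R ?e (X + t *\<^sub>R V)) \<bullet> V) (at t)"
      by (rule has_derivative_imp_has_field_derivative) (simp add: inner_commute)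
    then show ?thesis
      unfolding \<psi>_def \<psi>'_def by (auto intro!: derivative_eq_intros)
  qed
  have nonpos: "\<psi>' t \<le> 0" if t: "0 \<le> t" "t \<le> 1" for t
  proof -
    define Y where "Y = X + t *\<^sub>R V"
    have "Y = (1 - t) *\<^sub>R X + t *\<^sub>R (X + V)"
      by (simp add: Y_def algebra_simps)
    then have Y: "Y \<in> region_B f"
      using convexD_alt[OF convex_region_B X XV, of t] t by simp
    have YX: "norm (Y - X) = t * norm V"
      using t by (simp add: Y_def)
    have "(?H Y - ?H X) \<bullet> V \<le> norm (?H Y - ?H X) * norm V"
      by (rule norm_cauchy_schwarz)
    also have "\<dots> \<le> (L_tot f \<beta> * (t * norm V)) * norm V"
      using H_objective_lipschitz_B[OF Y X beta] by (intro mult_right_mono) (auto simp: YX)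
    finally have 1: "(?H Y - ?H X) \<bullet> V \<le> L_tot f \<beta> * t * (norm V)\<^sup>2"
      by (simp add: power2_eq_square mult_ac)
    have "norm (Y ** defect Y) \<le> norm (X ** defect X) + norm (Y ** defect Y - X ** defect X)"
      by (rule norm_triangle_sub)
    also have "\<dots> \<le> norm (X ** defect X) + L_b f * (t * norm V)"
      using penalty_gradient_lipschitz_B[OF Y X] by (simp add: YX)
    finally have grow: "norm (Y ** defect Y) \<le> norm (X ** defect X) + L_b f * (t * norm V)" .
    have "?e Y \<bullet> V \<le> norm (?e Y) * norm V"
      by (rule norm_cauchy_schwarz)
    also have "\<dots> \<le> (L_f f * (norm (X ** defect X) + L_b f * (t * norm V))) * norm V"
      using order_trans[OF gradient_gap_le_L_f[OF Y] mult_left_mono[OF grow L_f_nonneg]]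
      by (intro mult_right_mono) auto
    finally have 2: "?e Y \<bullet> V \<le> L_f f * norm (X ** defect X) * norm V + L_f f * L_b f * t * (norm V)\<^sup>2"
      by (simp add: power2_eq_square algebra_simps)
    show ?thesis
      using 1 2 unfolding \<psi>'_def A_def B_def Y_def[symmetric]
      by (simp add: inner_add_left inner_diff_left algebra_simps)
  qed
  have "\<psi> 1 \<le> \<psi> 0"
  proof (rule DERIV_nonpos_imp_nonincreasing[of 0 1 \<psi>])
    fix t :: real assume "0 \<le> t" "t \<le> 1"
    then show "\<exists>y. (\<psi> has_real_derivative y) (at t) \<and> y \<le> 0"
      by (intro exI[of _ "\<psi>' t"] conjI deriv nonpos)
  qed (rule zero_le_one)
  then show ?thesis
    by (simp add: \<psi>_def A_def B_def)
qed

text \<open>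
  The mean direction \<open>D\<close> is arbitrary here; its distance to \<open>H\<close> enters the bound. Writing
  \<open>H \<bullet> D\<close> by polarisation produces \<open>- \<eta> / 2 \<parallel>H\<parallel>\<^sup>2 - \<eta> / 2 \<parallel>D\<parallel>\<^sup>2\<close>. Of the second term, a quarter
  pays for the gap and an eighth for the curvature; of the first, \<open>\<beta> \<parallel>defect X\<parallel>\<^sup>2 / 8\<close> pays for the
  rest of the gap.
\<close>

lemma h_fun_descent:
  assumes X: "X \<in> region_R" and X': "X - \<eta> *\<^sub>R D \<in> region_R"
    and beta: "2 \<le> \<beta>" "(6 + 21 * C0 f) / 5 < \<beta>" "22 * (L_f f)\<^sup>2 < \<beta>"
    and eta: "0 < \<eta>" "\<eta> < 1 / (8 * L_tot f \<beta>)"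
  shows "h_fun f \<beta> (X - \<eta> *\<^sub>R D) \<le> h_fun f \<beta> X - \<eta> / 2 * (norm (G_loc (objective f) X))\<^sup>2
     - 3 / 8 * \<eta> * \<beta> * (norm (defect X))\<^sup>2 - \<eta> / 8 * (norm D)\<^sup>2
     + \<eta> / 2 * (norm (D - H_loc (objective f) \<beta> X))\<^sup>2"
proof -
  define H where "H = H_loc (objective f) \<beta> X"
  define P where "P = X ** defect X"
  let ?L = "L_tot f \<beta>"
  have "0 < \<beta> * L_b f"
    using beta(1) L_b_pos by simp
  then have L: "\<beta> * L_b f \<le> ?L" "0 < ?L"
    using L_g_nonneg by (auto simp: L_tot_def)
  have etaL: "\<eta> * ?L \<le> 1 / 8"
    using eta(2) L(2) by (simp add: field_simps)
  \<comment> \<open>\<open>L_f\<close> is of the order of \<open>\<surd>\<beta>\<close> at most, hence \<open>L_f L_b\<close> is a fraction of \<open>L \<ge> \<beta> L_b\<close>.\<close>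
  have "2 * \<beta> \<le> \<beta>\<^sup>2"
    unfolding power2_eq_square using beta(1) by (intro mult_right_mono) auto
  then have "(L_f f)\<^sup>2 \<le> (\<beta> / 6)\<^sup>2"
    using beta(1,3) unfolding power_divide by simp
  then have "L_f f \<le> \<beta> / 6"
    by (rule power2_le_imp_le) (use beta(1) in auto)
  then have "L_f f * L_b f \<le> \<beta> / 6 * L_b f"
    using L_b_pos by (intro mult_right_mono) auto
  then have "L_f f * L_b f \<le> ?L / 6"
    using L(1) by linarith
  then have "\<eta> * (?L / 2 + 3 / 4 * L_f f * L_b f) \<le> \<eta> * (5 / 8 * ?L)"
    using eta(1) by (intro mult_left_mono) (simp_all add: mult_ac)
  then have curv: "\<eta> * (?L / 2 + 3 / 4 * L_f f * L_b f) \<le> 1 / 8"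
    using etaL by simp
  have P: "(norm P)\<^sup>2 \<le> 7 / 6 * (norm (defect X))\<^sup>2"
    unfolding P_def by (rule norm_sq_mult_region_R[OF X])
  \<comment> \<open>With these weights \<open>22 L_f\<^sup>2 < \<beta>\<close> suffices, as \<open>9 / 4 * 7 / 6 / 22 < 1 / 8\<close>.\<close>
  have young: "3 / 2 * L_f f * norm P * norm D \<le> 1 / 4 * (norm D)\<^sup>2 + 1 / 8 * (\<beta> * (norm (defect X))\<^sup>2)"
  proof -
    have "0 \<le> (1 / 2 * norm D - 3 / 2 * (L_f f * norm P))\<^sup>2"
      by simp
    then have "3 / 2 * L_f f * norm P * norm D \<le> 1 / 4 * (norm D)\<^sup>2 + 9 / 4 * ((L_f f)\<^sup>2 * (norm P)\<^sup>2)"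
      by (simp add: power2_eq_square algebra_simps)
    moreover have "(L_f f)\<^sup>2 * (norm P)\<^sup>2 \<le> (\<beta> / 22) * (7 / 6 * (norm (defect X))\<^sup>2)"
      using P beta by (intro mult_mono) auto
    moreover have "0 \<le> \<beta> * (norm (defect X))\<^sup>2"
      using beta(1) by simp
    ultimately show ?thesis
      by (simp add: algebra_simps)
  qed
  have "h_fun f \<beta> (X - \<eta> *\<^sub>R D) \<le> h_fun f \<beta> X - \<eta> * (H \<bullet> D) + \<eta> * (3 / 2 * L_f f * norm P * norm D)
      + \<eta> * (\<eta> * (?L / 2 + 3 / 4 * L_f f * L_b f) * (norm D)\<^sup>2)"
    using h_fun_segment_bound[OF region_R_subset_B[OF X, of f], of "- \<eta> *\<^sub>R D" \<beta>] region_R_subset_B[OF X', of f]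
      beta(1) eta(1)
    by (simp add: H_def P_def power2_eq_square mult_ac)
  also have "\<dots> \<le> h_fun f \<beta> X - \<eta> * (H \<bullet> D)
      + \<eta> * (1 / 4 * (norm D)\<^sup>2 + 1 / 8 * (\<beta> * (norm (defect X))\<^sup>2)) + \<eta> * (1 / 8 * (norm D)\<^sup>2)"
    using young curv eta(1) by (intro add_mono mult_left_mono mult_right_mono order_refl) auto
  also have "H \<bullet> D = ((norm H)\<^sup>2 + (norm D)\<^sup>2 - (norm (D - H))\<^sup>2) / 2"
    by (simp add: power2_norm_eq_inner inner_diff_left inner_diff_right inner_commute)
  finally have "h_fun f \<beta> (X - \<eta> *\<^sub>R D) \<le> h_fun f \<beta> X - \<eta> / 2 * (norm H)\<^sup>2 + 1 / 8 * (\<eta> * (\<beta> * (norm (defect X))\<^sup>2))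
      - \<eta> / 8 * (norm D)\<^sup>2 + \<eta> / 2 * (norm (D - H))\<^sup>2"
    by (simp add: field_simps)
  moreover have "\<eta> / 2 * ((norm (G_loc (objective f) X))\<^sup>2 + \<beta> * (norm (defect X))\<^sup>2) \<le> \<eta> / 2 * (norm H)\<^sup>2"
    unfolding H_def using eta(1) beta by (intro mult_left_mono norm_sq_H_lower_bound X) auto
  ultimately show ?thesis
    unfolding H_def by (simp add: field_simps)
qed

end

section \<open>Dynamics of the iterates and descent of the merit function\<close>

text \<open>
  Squaring \<open>c \<le> \<theta> a + b\<close> by Young's inequality with the weight that splits the available
  contraction \<open>1 - \<theta>\<^sup>2\<close> in halves. With it the coefficients of \<open>b\<^sup>2\<close> become those in \<open>C1\<close> and \<open>C2\<close>.
  Only divisions by \<open>1 - \<theta>\<^sup>2\<close> occur, so the case \<open>\<theta> = 0\<close> is covered.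
\<close>

lemma contraction_young:
  fixes \<theta> :: real
  assumes "0 \<le> \<theta>" "\<theta> < 1" "0 \<le> c" "c \<le> \<theta> * a + b"
  shows "c\<^sup>2 \<le> (1 + \<theta>\<^sup>2) / 2 * a\<^sup>2 + (1 + \<theta>\<^sup>2) / (1 - \<theta>\<^sup>2) * b\<^sup>2"
proof -
  define s where "s = 1 - \<theta>\<^sup>2"
  have s: "0 < s" "\<theta>\<^sup>2 = 1 - s"
    using assms by (simp_all add: s_def power_less_one_iff abs_square_less_1)
  have "0 \<le> (s * a - 2 * \<theta> * b)\<^sup>2 / (2 * s)"
    using s by simp
  also have "\<dots> = s / 2 * a\<^sup>2 - 2 * \<theta> * a * b + 2 * \<theta>\<^sup>2 / s * b\<^sup>2"
    using s(1) by (simp add: power2_eq_square field_simps)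
  finally have young: "2 * \<theta> * a * b \<le> s / 2 * a\<^sup>2 + 2 * \<theta>\<^sup>2 / s * b\<^sup>2"
    by simp
  have "c\<^sup>2 \<le> (\<theta> * a + b)\<^sup>2"
    using assms by (intro power_mono) auto
  also have "\<dots> = \<theta>\<^sup>2 * a\<^sup>2 + 2 * \<theta> * a * b + b\<^sup>2"
    by (simp add: power2_eq_square algebra_simps)
  also have "\<dots> \<le> \<theta>\<^sup>2 * a\<^sup>2 + (s / 2 * a\<^sup>2 + 2 * \<theta>\<^sup>2 / s * b\<^sup>2) + b\<^sup>2"
    using young by simp
  also have "\<dots> = (1 + \<theta>\<^sup>2) / 2 * a\<^sup>2 + (1 + \<theta>\<^sup>2) / s * b\<^sup>2"
    using s(1) unfolding s(2) by (simp add: field_simps)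
  finally show ?thesis
    by (simp add: s_def)
qed

locale destiny = smooth_problem f + mixing_network E W
  for f :: "'d::finite \<Rightarrow> real^'p::finite^'n::finite \<Rightarrow> real"
    and E :: "('d \<times> 'd) set" and W :: "real^'d^'d" +
  fixes \<beta> \<eta> :: real and X_init :: "real^'p^'n" and X D :: "nat \<Rightarrow> 'd \<Rightarrow> real^'p^'n"
  assumes penalty: "penalty_condition f \<beta>"
    and stepsize: "stepsize_condition f W \<beta> (stack (D 0)) \<eta>"
    and init: "X_init \<in> region_R"
    and iterates: "destiny_iterates f W \<beta> \<eta> X_init X D"
begin

abbreviation "L \<equiv> L_tot f \<beta>"
abbreviation "\<rho> \<equiv> rho f W \<beta>"

lemma beta_bounds:
  "0 < \<beta>" "(6 + 21 * C0 f) / 5 < \<beta>" "72 * (4 + 3 * M_g f) / 5 < \<beta>" "1 / L_b f < \<beta>" "22 * (L_f f)\<^sup>2 < \<beta>"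
  using penalty by (auto simp: penalty_condition_def)

lemma beta_large: "57 < \<beta>"
  using beta_bounds(3) M_g_nonneg by simp

text \<open>
  Bounds divided by \<open>L\<close> are therefore also bounds as such; the condition \<open>\<beta> > 1 / L_b\<close> serves this
  purpose.
\<close>

lemma L_gt_1: "1 < L"
proof -
  have "1 < \<beta> * L_b f"
    using beta_bounds(4) L_b_pos by (simp add: field_simps)
  then show ?thesis
    using L_g_nonneg by (simp add: L_tot_def)
qed

lemma C_D_eq: "C_D f W \<beta> (stack (D 0))
    = disagreement (D 0) + 3 * sqrt (real CARD('d)) / (1 - \<theta>) + sqrt (real CARD('d)) * (M_g f + \<beta> * M_b f)"
  by (simp add: C_D_def norm_J_mat_stack)

lemma disagreement_nonneg: "0 \<le> disagreement Z"
  by (simp add: disagreement_def)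

lemma C_D_pos: "0 < C_D f W \<beta> (stack (D 0))"
proof -
  have "0 < 3 * sqrt (real CARD('d)) / (1 - \<theta>)"
    using mixing_rate_less_1 by simp
  moreover have "0 \<le> sqrt (real CARD('d)) * (M_g f + \<beta> * M_b f)"
    using M_g_nonneg M_b_nonneg beta_bounds(1) by simp
  ultimately show ?thesis
    unfolding C_D_eq using disagreement_nonneg[of "D 0"] by linarith
qed

lemma eta_pos: "0 < \<eta>"
  and eta_tube: "\<eta> < 216 / (49 * \<beta>\<^sup>2)" "\<eta> < 1 / (18 * (4 + 3 * M_g f))"
  and eta_C_D: "\<eta> * C_D f W \<beta> (stack (D 0)) \<le> sqrt (real CARD('d)) / L"
  and eta_theta_C_D: "\<eta> * \<theta> * C_D f W \<beta> (stack (D 0)) \<le> (1 - \<theta>) * (sqrt (real CARD('d)) / L)"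
  and eta_L: "\<eta> < 1 / (8 * L)"
  and eta_rho: "4 * \<rho> * real CARD('d) * C2 f W \<beta> > 0 \<Longrightarrow> \<eta> * (4 * \<rho> * real CARD('d) * C2 f W \<beta>) \<le> 1"
  and eta_L2: "\<eta> * (12 * L\<^sup>2) \<le> real CARD('d) * (1 - \<theta>\<^sup>2)"
  and eta_C1: "\<theta> \<noteq> 0 \<Longrightarrow> \<eta> < sqrt (3 * \<rho> * (1 - \<theta>\<^sup>2) / (16 * C1 W))"
proof -
  note * = stepsize[unfolded stepsize_condition_def Let_def]
  show "0 < \<eta>" "\<eta> < 216 / (49 * \<beta>\<^sup>2)" "\<eta> < 1 / (18 * (4 + 3 * M_g f))" "\<eta> < 1 / (8 * L)"
    using * by blast+
  show "\<theta> \<noteq> 0 \<Longrightarrow> \<eta> < sqrt (3 * \<rho> * (1 - \<theta>\<^sup>2) / (16 * C1 W))"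
    using * by blast
  let ?C = "C_D f W \<beta> (stack (D 0))"
  have "\<eta> < sqrt (real CARD('d)) / (L * ?C)"
    using * by blast
  then show "\<eta> * ?C \<le> sqrt (real CARD('d)) / L"
    using L_gt_1 C_D_pos by (simp add: field_simps)
  show "\<eta> * \<theta> * ?C \<le> (1 - \<theta>) * (sqrt (real CARD('d)) / L)"
  proof (cases "\<theta> = 0")
    case True
    then show ?thesis
      using L_gt_1 by simp
  next
    case False
    then have "\<eta> < sqrt (real CARD('d)) * (1 - \<theta>) / (L * \<theta> * ?C)"
      using * by blast
    then show ?thesis
      using L_gt_1 C_D_pos False mixing_rate_nonneg by (simp add: field_simps)
  qed
  have "\<eta> < 1 / (4 * \<rho> * real CARD('d) * C2 f W \<beta>)"
    using * by blast
  then show "4 * \<rho> * real CARD('d) * C2 f W \<beta> > 0 \<Longrightarrow> \<eta> * (4 * \<rho> * real CARD('d) * C2 f W \<beta>) \<le> 1"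
    by (simp add: field_simps)
  have "\<eta> < real CARD('d) * (1 - \<theta>\<^sup>2) / (12 * L\<^sup>2)"
    using * by blast
  then show "\<eta> * (12 * L\<^sup>2) \<le> real CARD('d) * (1 - \<theta>\<^sup>2)"
    using L_gt_1 by (simp add: field_simps)
qed

lemma X_0: "X 0 i = X_init"
  and D_0: "D 0 i = H_loc (f i) \<beta> (X 0 i)"
  using iterates by (auto simp: destiny_iterates_def)

lemma X_Suc: "X (Suc k) = mix W (\<lambda>j. X k j - \<eta> *\<^sub>R D k j)"
  using iterates by (auto simp: destiny_iterates_def mix_def)

lemma D_Suc: "D (Suc k) = (\<lambda>i. mix W (D k) i + (H_loc (f i) \<beta> (X (Suc k) i) - H_loc (f i) \<beta> (X k i)))"
  using iterates by (auto simp: destiny_iterates_def mix_def)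

lemma avg_X_Suc: "avg (X (Suc k)) = avg (X k) - \<eta> *\<^sub>R avg (D k)"
proof -
  have "avg (\<lambda>j. \<eta> *\<^sub>R D k j) = \<eta> *\<^sub>R avg (D k)"
    by (rule linear_avg[symmetric]) (rule linear_scale_self)
  then show ?thesis
    unfolding X_Suc avg_mix by (simp flip: avg_diff)
qed

text \<open>
  The tracking property: the correction added in each step makes the mean of the \<open>D\<close>-blocks follow
  the mean of the current directions.
\<close>

lemma avg_D: "avg (D k) = avg (\<lambda>i. H_loc (f i) \<beta> (X k i))"
proof (induction k)
  case 0
  then show ?case
    by (simp add: D_0)
next
  case (Suc k)
  have "avg (D (Suc k)) = avg (mix W (D k))
      + (avg (\<lambda>i. H_loc (f i) \<beta> (X (Suc k) i)) - avg (\<lambda>i. H_loc (f i) \<beta> (X k i)))"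
    by (subst D_Suc) (simp add: avg_add avg_diff)
  then show ?case
    using Suc by (simp add: avg_mix)
qed

lemma disagreement_X_Suc:
  "disagreement (X (Suc k)) \<le> \<theta> * disagreement (X k) + \<eta> * \<theta> * disagreement (D k)"
proof -
  have "disagreement (\<lambda>j. X k j - \<eta> *\<^sub>R D k j) \<le> disagreement (X k) + \<eta> * disagreement (D k)"
    using disagreement_add_le[of "X k" "\<lambda>j. (- \<eta>) *\<^sub>R D k j"] disagreement_scaleR[of "- \<eta>" "D k"] eta_pos
    by simp
  then have "\<theta> * disagreement (\<lambda>j. X k j - \<eta> *\<^sub>R D k j) \<le> \<theta> * (disagreement (X k) + \<eta> * disagreement (D k))"
    using mixing_rate_nonneg by (rule mult_left_mono)
  then show ?thesis
    using disagreement_mix_le[of "\<lambda>j. X k j - \<eta> *\<^sub>R D k j"] by (simp add: X_Suc algebra_simps)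
qed

definition increment :: "nat \<Rightarrow> real" where
  "increment k = norm (stack (\<lambda>i. X (Suc k) i - X k i))"

text \<open>
  The change of the iterate splits orthogonally into the step of the mean and the change of the
  deviations from the mean.
\<close>

lemma increment_sq:
  "(increment k)\<^sup>2 \<le> real CARD('d) * \<eta>\<^sup>2 * (norm (avg (D k)))\<^sup>2 + (disagreement (X (Suc k)) + disagreement (X k))\<^sup>2"
proof -
  define Y where "Y i = (X (Suc k) i - avg (X (Suc k))) - (X k i - avg (X k))" for i
  have "avg Y = 0"
    using avg_minus_avg[of "X (Suc k)"] avg_minus_avg[of "X k"] unfolding Y_def
    by (simp flip: avg_diff)
  then have "(norm (stack (\<lambda>i. (- \<eta> *\<^sub>R avg (D k)) + Y i)))\<^sup>2
      = real CARD('d) * (norm (- \<eta> *\<^sub>R avg (D k)))\<^sup>2 + (norm (stack Y))\<^sup>2"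
    by (rule norm_sq_stack_split)
  moreover have "(\<lambda>i. (- \<eta> *\<^sub>R avg (D k)) + Y i) = (\<lambda>i. X (Suc k) i - X k i)"
    by (rule ext) (simp add: Y_def avg_X_Suc)
  ultimately have "(increment k)\<^sup>2 = real CARD('d) * (norm (- \<eta> *\<^sub>R avg (D k)))\<^sup>2 + (norm (stack Y))\<^sup>2"
    by (simp add: increment_def)
  moreover have "norm (stack Y) \<le> disagreement (X (Suc k)) + disagreement (X k)"
    unfolding Y_def stack_diff[of "\<lambda>i. X (Suc k) i - avg (X (Suc k))"] disagreement_def
    by (rule norm_triangle_ineq4)
  then have "(norm (stack Y))\<^sup>2 \<le> (disagreement (X (Suc k)) + disagreement (X k))\<^sup>2"
    by (rule power_mono) simp
  ultimately show ?thesis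
    by (simp add: power_mult_distrib mult_ac)
qed

lemma disagreement_D_Suc:
  assumes "\<And>i. X k i \<in> region_B f" "\<And>i. X (Suc k) i \<in> region_B f"
  shows "disagreement (D (Suc k)) \<le> \<theta> * disagreement (D k) + L * increment k"
proof -
  let ?\<Delta> = "\<lambda>i. H_loc (f i) \<beta> (X (Suc k) i) - H_loc (f i) \<beta> (X k i)"
  have "disagreement ?\<Delta> \<le> norm (stack ?\<Delta>)"
    by (rule disagreement_le_norm)
  also have "\<dots> \<le> L * increment k"
    unfolding increment_def using L_gt_1 beta_bounds(1)
    by (intro norm_stack_mono H_loc_lipschitz_B assms) auto
  finally have "disagreement ?\<Delta> \<le> L * increment k" .
  moreover have "disagreement (D (Suc k)) \<le> disagreement (mix W (D k)) + disagreement ?\<Delta>"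
    unfolding D_Suc by (rule disagreement_add_le)
  ultimately show ?thesis
    using disagreement_mix_le[of "D k"] by linarith
qed

lemma tracking_error:
  assumes "avg (X k) \<in> region_B f" "\<And>i. X k i \<in> region_B f"
  shows "norm (avg (D k) - H_loc (objective f) \<beta> (avg (X k))) \<le> L / sqrt (real CARD('d)) * disagreement (X k)"
proof -
  let ?\<Delta> = "\<lambda>i. H_loc (f i) \<beta> (X k i) - H_loc (f i) \<beta> (avg (X k))"
  have "avg (D k) - H_loc (objective f) \<beta> (avg (X k)) = avg ?\<Delta>"
    by (simp add: avg_D avg_diff flip: H_avg_eq)
  also have "norm \<dots> \<le> norm (stack ?\<Delta>) / sqrt (real CARD('d))"
    by (rule norm_avg_le_norm_stack)
  also have "norm (stack ?\<Delta>) \<le> L * disagreement (X k)"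
    unfolding disagreement_def using L_gt_1 beta_bounds(1)
    by (intro norm_stack_mono H_loc_lipschitz_B assms) auto
  finally show ?thesis
    by (simp add: divide_right_mono)
qed

text \<open>
  The induction invariant. The bound on the disagreement has the factor \<open>1 / L\<close> so that, by
  \<open>tracking_error\<close>, the mean direction is at distance at most \<open>1\<close> from \<open>H\<close> at the mean.
\<close>

definition controlled :: "nat \<Rightarrow> bool" where
  "controlled k \<longleftrightarrow> avg (X k) \<in> region_R \<and> disagreement (X k) \<le> sqrt (real CARD('d)) / L
     \<and> disagreement (D k) \<le> disagreement (D 0) + 3 * sqrt (real CARD('d)) / (1 - \<theta>)"

lemma sqrt_card_div_L_le: "sqrt (real CARD('d)) / L \<le> sqrt (real CARD('d))"
  using L_gt_1 by (simp add: field_simps)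

lemma controlled_region_B:
  assumes "controlled k"
  shows "avg (X k) \<in> region_B f" "X k i \<in> region_B f"
proof -
  show "avg (X k) \<in> region_B f"
    using assms by (simp add: controlled_def region_R_subset_B)
  have "norm (X k i - avg (X k)) \<le> disagreement (X k)"
    unfolding disagreement_def by (rule norm_component_le_stack)
  then show "X k i \<in> region_B f"
    using assms sqrt_card_div_L_le by (intro region_B_near_region_R[of "avg (X k)"]) (auto simp: controlled_def)
qed

lemma controlled_D:
  assumes "controlled k"
  shows "norm (stack (D k)) \<le> C_D f W \<beta> (stack (D 0))"
    and "sqrt (real CARD('d)) * norm (avg (D k)) \<le> C_D f W \<beta> (stack (D 0))"
    and "disagreement (D k) \<le> C_D f W \<beta> (stack (D 0))"
proof -
  have "norm (avg (D k)) \<le> M_g f + \<beta> * M_b f"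
    unfolding avg_D using beta_bounds(1) controlled_region_B[OF assms]
    by (intro norm_avg_le norm_H_loc_le) auto
  then have "sqrt (real CARD('d)) * norm (avg (D k)) \<le> sqrt (real CARD('d)) * (M_g f + \<beta> * M_b f)"
    by (rule mult_left_mono) simp
  moreover have "0 \<le> sqrt (real CARD('d)) * norm (avg (D k))"
    by simp
  ultimately show "norm (stack (D k)) \<le> C_D f W \<beta> (stack (D 0))"
    "sqrt (real CARD('d)) * norm (avg (D k)) \<le> C_D f W \<beta> (stack (D 0))"
    "disagreement (D k) \<le> C_D f W \<beta> (stack (D 0))"
    using assms norm_stack_le[of "D k"] disagreement_nonneg[of "D k"]
    unfolding C_D_eq controlled_def by linarith+
qed

lemma controlled_Suc:
  assumes k: "controlled k"
  shows "controlled (Suc k)"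
proof -
  have R: "avg (X k) \<in> region_R" and u: "disagreement (X k) \<le> sqrt (real CARD('d)) / L"
    and v: "disagreement (D k) \<le> disagreement (D 0) + 3 * sqrt (real CARD('d)) / (1 - \<theta>)"
    using k by (auto simp: controlled_def)
  note B = controlled_region_B[OF k]
  let ?C = "C_D f W \<beta> (stack (D 0))"
  have "\<theta> * disagreement (X k) \<le> \<theta> * (sqrt (real CARD('d)) / L)"
    using u mixing_rate_nonneg by (rule mult_left_mono)
  moreover have "\<eta> * \<theta> * disagreement (D k) \<le> \<eta> * \<theta> * ?C"
    using eta_pos mixing_rate_nonneg by (intro mult_left_mono controlled_D k) auto
  moreover have "(1 - \<theta>) * (sqrt (real CARD('d)) / L) = sqrt (real CARD('d)) / L - \<theta> * (sqrt (real CARD('d)) / L)"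
    by (simp only: left_diff_distrib mult_1)
  ultimately have u': "disagreement (X (Suc k)) \<le> sqrt (real CARD('d)) / L"
    using disagreement_X_Suc[of k] eta_theta_C_D by linarith
  have R': "avg (X (Suc k)) \<in> region_R"
  proof -
    \<comment> \<open>By definition of \<open>H\<close> this is \<open>G\<close> at the mean plus the tracking error.\<close>
    let ?S = "avg (D k) - \<beta> *\<^sub>R (avg (X k) ** defect (avg (X k)))"
    have "L / sqrt (real CARD('d)) * disagreement (X k) \<le> L / sqrt (real CARD('d)) * (sqrt (real CARD('d)) / L)"
      using u L_gt_1 by (intro mult_left_mono) auto
    moreover have "L / sqrt (real CARD('d)) * (sqrt (real CARD('d)) / L) = 1"
      using L_gt_1 by simp
    ultimately have "norm (avg (D k) - H_loc (objective f) \<beta> (avg (X k))) \<le> 1"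
      using tracking_error[OF B] by linarith
    then have "norm (G_loc (objective f) (avg (X k)) + (avg (D k) - H_loc (objective f) \<beta> (avg (X k)))) \<le> M_g f + 1"
      by (intro norm_triangle_le add_mono norm_G_objective_le_M_g B)
    also have "G_loc (objective f) (avg (X k)) + (avg (D k) - H_loc (objective f) \<beta> (avg (X k))) = ?S"
      by (simp add: H_loc_eq)
    finally have "norm ?S \<le> 1 + M_g f"
      by simp
    from region_R_step[OF R this M_g_nonneg beta_bounds(3) eta_pos eta_tube]
    show ?thesis
      by (simp add: avg_X_Suc)
  qed
  have "norm (X (Suc k) i - avg (X (Suc k))) \<le> sqrt (real CARD('d))" for i
    using norm_component_le_stack[of "\<lambda>i. X (Suc k) i - avg (X (Suc k))" i] u' sqrt_card_div_L_le
    by (simp add: disagreement_def)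
  then have B': "X (Suc k) i \<in> region_B f" for i
    by (rule region_B_near_region_R[OF R'])
  \<comment> \<open>One third for the step of the mean and one for each of the two disagreements.\<close>
  have "increment k \<le> 3 * (sqrt (real CARD('d)) / L)"
  proof -
    have "(increment k)\<^sup>2 \<le> (\<eta> * (sqrt (real CARD('d)) * norm (avg (D k))))\<^sup>2 + (disagreement (X (Suc k)) + disagreement (X k))\<^sup>2"
      using increment_sq[of k] by (simp add: power_mult_distrib mult_ac)
    also have "\<dots> \<le> (\<eta> * (sqrt (real CARD('d)) * norm (avg (D k))) + (disagreement (X (Suc k)) + disagreement (X k)))\<^sup>2"
      using eta_pos disagreement_nonneg[of "X (Suc k)"] disagreement_nonneg[of "X k"]
      by (simp add: power2_sum)
    finally have "increment k \<le> \<eta> * (sqrt (real CARD('d)) * norm (avg (D k))) + (disagreement (X (Suc k)) + disagreement (X k))"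
      by (rule power2_le_imp_le)
         (use eta_pos disagreement_nonneg[of "X (Suc k)"] disagreement_nonneg[of "X k"] in auto)
    moreover have "\<eta> * (sqrt (real CARD('d)) * norm (avg (D k))) \<le> \<eta> * ?C"
      using eta_pos by (intro mult_left_mono controlled_D k) auto
    ultimately show ?thesis
      using eta_C_D u u' by linarith
  qed
  then have "L * increment k \<le> L * (3 * (sqrt (real CARD('d)) / L))"
    using L_gt_1 by (intro mult_left_mono) auto
  then have "L * increment k \<le> 3 * sqrt (real CARD('d))"
    using L_gt_1 by simp
  moreover have "\<theta> * disagreement (D k) \<le> \<theta> * (disagreement (D 0) + 3 * sqrt (real CARD('d)) / (1 - \<theta>))"
    using v mixing_rate_nonneg by (rule mult_left_mono)
  moreover have "\<theta> * (3 * sqrt (real CARD('d)) / (1 - \<theta>)) + 3 * sqrt (real CARD('d)) = 3 * sqrt (real CARD('d)) / (1 - \<theta>)"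
    using mixing_rate_less_1 by (simp add: field_simps)
  moreover have "\<theta> * disagreement (D 0) \<le> disagreement (D 0)"
    using mixing_rate_nonneg mixing_rate_less_1 disagreement_nonneg[of "D 0"] by (simp add: mult_left_le_one_le)
  ultimately have "disagreement (D (Suc k)) \<le> disagreement (D 0) + 3 * sqrt (real CARD('d)) / (1 - \<theta>)"
    using disagreement_D_Suc[OF B(2) B'] by (simp add: distrib_left)
  then show ?thesis
    using R' u' by (simp add: controlled_def)
qed

lemma controlled: "controlled k"
proof (induction k)
  case 0
  have "X 0 = (\<lambda>i. X_init)"
    using X_0 by auto
  then have "disagreement (X 0) = 0" "avg (X 0) = X_init"
    using norm_stack_const[where 'd = 'd and A = "0 :: real^'p^'n"] by (simp_all add: disagreement_def)
  then show ?case
    using init L_gt_1 mixing_rate_less_1 by (simp add: controlled_def)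
next
  case (Suc k)
  then show ?case
    by (rule controlled_Suc)
qed

lemma avg_X_in_R: "avg (X k) \<in> region_R"
  using controlled[of k] by (simp add: controlled_def)

lemma one_minus_theta_sq_pos: "0 < 1 - \<theta>\<^sup>2"
  using mixing_rate_nonneg mixing_rate_less_1 by (simp add: power_less_one_iff abs_square_less_1)

lemma C2_pos: "0 < C2 f W \<beta>"
  using L_gt_1 one_minus_theta_sq_pos by (simp add: C2_def Let_def add_pos_nonneg)

lemma rho_C2: "\<rho> * C2 f W \<beta> = 3 / 16 * (1 - \<theta>\<^sup>2)"
  using C2_pos by (simp add: rho_def)

lemma rho_pos: "0 < \<rho>"
  using C2_pos one_minus_theta_sq_pos by (simp add: rho_def)

text \<open>
  When the mixing rate vanishes, so does \<open>C1\<close>, and the stepsize is not bounded in terms of it.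
\<close>

lemma eta_sq_C1: "\<eta>\<^sup>2 * C1 W \<le> 3 / 16 * \<rho> * (1 - \<theta>\<^sup>2)"
proof (cases "\<theta> = 0")
  case True
  then show ?thesis
    using rho_pos by (simp add: C1_def)
next
  case False
  then have C1: "0 < C1 W"
    using one_minus_theta_sq_pos by (simp add: C1_def Let_def add_pos_nonneg)
  then have nn: "0 \<le> 3 * \<rho> * (1 - \<theta>\<^sup>2) / (16 * C1 W)"
    using rho_pos one_minus_theta_sq_pos by simp
  have "\<eta>\<^sup>2 \<le> (sqrt (3 * \<rho> * (1 - \<theta>\<^sup>2) / (16 * C1 W)))\<^sup>2"
    using eta_C1[OF False] eta_pos by (intro power_mono) auto
  then show ?thesis
    using nn C1 by (simp add: field_simps)
qed

lemma disagreement_X_Suc_sq: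
  "(disagreement (X (Suc k)))\<^sup>2 \<le> (1 + \<theta>\<^sup>2) / 2 * (disagreement (X k))\<^sup>2 + C1 W * \<eta>\<^sup>2 * (disagreement (D k))\<^sup>2"
  using contraction_young[OF mixing_rate_nonneg mixing_rate_less_1 disagreement_nonneg disagreement_X_Suc[of k]]
  by (simp add: C1_def Let_def power_mult_distrib mult_ac)

text \<open>
  The coefficient of the squared increment in the contraction estimate is \<open>C2 / 12\<close>.
\<close>

lemma disagreement_D_Suc_sq:
  "(disagreement (D (Suc k)))\<^sup>2 \<le> (1 + \<theta>\<^sup>2) / 2 * (disagreement (D k))\<^sup>2
     + C2 f W \<beta> / 12 * (8 * (disagreement (X k))\<^sup>2 + 2 * \<eta>\<^sup>2 * \<theta>\<^sup>2 * (disagreement (D k))\<^sup>2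
         + real CARD('d) * \<eta>\<^sup>2 * (norm (avg (D k)))\<^sup>2)"
proof -
  let ?x = "disagreement (X k)" and ?y = "\<eta> * \<theta> * disagreement (D k)"
  have "disagreement (X (Suc k)) + ?x \<le> 2 * ?x + ?y"
    using disagreement_X_Suc[of k] mixing_rate_less_1 mult_right_mono[of \<theta> 1 ?x] disagreement_nonneg[of "X k"]
    by simp
  then have "(disagreement (X (Suc k)) + ?x)\<^sup>2 \<le> (2 * ?x + ?y)\<^sup>2"
    using disagreement_nonneg[of "X k"] disagreement_nonneg[of "X (Suc k)"] by (intro power_mono) auto
  also have "\<dots> \<le> 8 * ?x\<^sup>2 + 2 * ?y\<^sup>2"
    using sum_squares_bound[of "2 * ?x" ?y] by (simp add: power2_sum power_mult_distrib)
  finally have w: "(increment k)\<^sup>2 \<le> 8 * ?x\<^sup>2 + 2 * \<eta>\<^sup>2 * \<theta>\<^sup>2 * (disagreement (D k))\<^sup>2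
      + real CARD('d) * \<eta>\<^sup>2 * (norm (avg (D k)))\<^sup>2"
    using increment_sq[of k] by (simp add: power_mult_distrib)
  have "(disagreement (D (Suc k)))\<^sup>2 \<le> (1 + \<theta>\<^sup>2) / 2 * (disagreement (D k))\<^sup>2
      + (1 + \<theta>\<^sup>2) / (1 - \<theta>\<^sup>2) * (L * increment k)\<^sup>2"
    using controlled_region_B(2)[OF controlled]
    by (intro contraction_young mixing_rate_nonneg mixing_rate_less_1 disagreement_nonneg disagreement_D_Suc)
  also have "(1 + \<theta>\<^sup>2) / (1 - \<theta>\<^sup>2) * (L * increment k)\<^sup>2 = C2 f W \<beta> / 12 * (increment k)\<^sup>2"
    using one_minus_theta_sq_pos by (simp add: C2_def Let_def power_mult_distrib field_simps)
  also have "\<dots> \<le> C2 f W \<beta> / 12 * (8 * ?x\<^sup>2 + 2 * \<eta>\<^sup>2 * \<theta>\<^sup>2 * (disagreement (D k))\<^sup>2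
      + real CARD('d) * \<eta>\<^sup>2 * (norm (avg (D k)))\<^sup>2)"
    using w C2_pos by (intro mult_left_mono) auto
  finally show ?thesis
    by simp
qed

definition merit_at :: "nat \<Rightarrow> real" where
  "merit_at k = merit f W \<beta> (stack (X k)) (stack (D k))"

lemma merit_at_eq: "merit_at k
    = h_fun f \<beta> (avg (X k)) + (disagreement (X k))\<^sup>2 + \<rho> * (disagreement (D k))\<^sup>2"
  by (simp add: merit_at_def merit_def block_mean_stack norm_J_mat_stack)

text \<open>
  What the merit function loses in each step.
\<close>

definition decrease :: "nat \<Rightarrow> real" where
  "decrease k = \<eta> / 2 * (norm (G_avg f (avg (X k))))\<^sup>2 + 3 / 8 * \<eta> * \<beta> * (norm (defect (avg (X k))))\<^sup>2
     + (1 - \<theta>\<^sup>2) / 3 * (disagreement (X k))\<^sup>2"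

text \<open>
  The weight \<open>\<rho>\<close> is such that \<open>\<rho> C2 = 3 / 16 (1 - \<theta>\<^sup>2)\<close>. With \<open>s = 1 - \<theta>\<^sup>2\<close>, the contraction provides
  \<open>s / 2\<close> of each squared disagreement. For \<open>X\<close>, the tracking error in \<open>h\<close> consumes \<open>s / 24\<close>
  and the coupling into \<open>D\<close> consumes \<open>s / 8\<close>, leaving \<open>s / 3\<close>. For \<open>D\<close>, in units of \<open>\<rho>\<close>, the
  coupling into \<open>X\<close> consumes \<open>3 s / 16\<close> and the feedback through the increment \<open>s / 16\<close>. The mean
  direction enters with \<open>\<eta> / 48\<close>, less than the \<open>\<eta> / 8\<close> gained in the descent of \<open>h\<close>.
\<close>

lemma merit_descent: "merit_at (Suc k) + decrease k \<le> merit_at k"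
proof -
  define u v n where "u = (disagreement (X k))\<^sup>2" and "v = (disagreement (D k))\<^sup>2"
    and "n = (norm (avg (D k)))\<^sup>2"
  define s where "s = 1 - \<theta>\<^sup>2"
  have nonneg: "0 \<le> u" "0 \<le> v" "0 \<le> n" "0 < s" "s \<le> 1"
    using one_minus_theta_sq_pos by (simp_all add: u_def v_def n_def s_def)
  have track: "\<eta> / 2 * (norm (avg (D k) - H_loc (objective f) \<beta> (avg (X k))))\<^sup>2 \<le> s / 24 * u"
  proof -
    have "(norm (avg (D k) - H_loc (objective f) \<beta> (avg (X k))))\<^sup>2 \<le> (L / sqrt (real CARD('d)) * disagreement (X k))\<^sup>2"
      by (intro power_mono tracking_error controlled_region_B controlled) auto
    then have "\<eta> / 2 * (norm (avg (D k) - H_loc (objective f) \<beta> (avg (X k))))\<^sup>2 \<le> \<eta> / 2 * (L\<^sup>2 / real CARD('d) * u)"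
      using eta_pos by (intro mult_left_mono) (auto simp: u_def power_mult_distrib power_divide)
    also have "\<dots> = (\<eta> * (12 * L\<^sup>2)) * u / (24 * real CARD('d))"
      by simp
    also have "\<dots> \<le> (real CARD('d) * s) * u / (24 * real CARD('d))"
      using eta_L2 nonneg unfolding s_def by (intro divide_right_mono mult_right_mono) auto
    finally show ?thesis
      by simp
  qed
  have h: "h_fun f \<beta> (avg (X (Suc k))) \<le> h_fun f \<beta> (avg (X k)) - \<eta> / 2 * (norm (G_avg f (avg (X k))))\<^sup>2
      - 3 / 8 * \<eta> * \<beta> * (norm (defect (avg (X k))))\<^sup>2 - \<eta> / 8 * n + s / 24 * u"
    using h_fun_descent[OF avg_X_in_R[of k] avg_X_in_R[of "Suc k", unfolded avg_X_Suc] _ beta_bounds(2,5) eta_pos eta_L]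
      beta_large track
    by (simp add: avg_X_Suc n_def G_avg_eq)
  have U: "(disagreement (X (Suc k)))\<^sup>2 \<le> (1 - s / 2) * u + 3 / 16 * (\<rho> * s) * v"
  proof -
    have "\<eta>\<^sup>2 * C1 W * v \<le> 3 / 16 * \<rho> * s * v"
      using eta_sq_C1 nonneg unfolding s_def by (intro mult_right_mono) auto
    then show ?thesis
      using disagreement_X_Suc_sq[of k] by (simp add: u_def v_def s_def field_simps)
  qed
  have V: "\<rho> * (disagreement (D (Suc k)))\<^sup>2 \<le> \<rho> * (1 - s / 2) * v + s / 8 * u + \<rho> * s / 16 * v + \<eta> / 48 * n"
  proof -
    \<comment> \<open>The feedback term carries \<open>\<eta>\<^sup>2 \<theta>\<^sup>2\<close>, for which the stepsize bound in terms of \<open>C1\<close> is strong enough.\<close>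
    have "\<theta>\<^sup>2 \<le> C1 W"
    proof -
      have "\<theta>\<^sup>2 * s \<le> \<theta>\<^sup>2 * (1 + \<theta>\<^sup>2)"
        by (rule mult_left_mono) (simp_all add: s_def)
      then show ?thesis
        using nonneg by (simp add: C1_def Let_def s_def[symmetric] pos_le_divide_eq)
    qed
    then have "\<eta>\<^sup>2 * \<theta>\<^sup>2 \<le> \<eta>\<^sup>2 * C1 W"
      by (rule mult_left_mono) simp
    then have "\<eta>\<^sup>2 * \<theta>\<^sup>2 \<le> 3 / 16 * \<rho> * s"
      using eta_sq_C1 by (simp add: s_def)
    then have "C2 f W \<beta> / 6 * (\<eta>\<^sup>2 * \<theta>\<^sup>2) \<le> C2 f W \<beta> / 6 * (3 / 16 * \<rho> * s)"
      using C2_pos by (intro mult_left_mono) auto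
    also have "\<dots> = (\<rho> * C2 f W \<beta>) * s / 32"
      by simp
    also have "\<dots> \<le> s / 16"
      unfolding rho_C2 using nonneg mult_left_le[of s s] by (simp add: s_def[symmetric])
    finally have "\<rho> * v * (C2 f W \<beta> / 6 * (\<eta>\<^sup>2 * \<theta>\<^sup>2)) \<le> \<rho> * v * (s / 16)"
      using nonneg rho_pos by (intro mult_left_mono) auto
    then have 1: "\<rho> * (C2 f W \<beta> / 12 * (2 * \<eta>\<^sup>2 * \<theta>\<^sup>2 * v)) \<le> \<rho> * s / 16 * v"
      by (simp add: mult_ac)
    have "\<eta> * (4 * \<rho> * real CARD('d) * C2 f W \<beta>) \<le> 1"
      using rho_pos C2_pos by (intro eta_rho) simp
    then have "\<eta> * n / 48 * (\<eta> * (4 * \<rho> * real CARD('d) * C2 f W \<beta>)) \<le> \<eta> * n / 48 * 1"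
      using nonneg eta_pos by (intro mult_left_mono) auto
    then have 2: "\<rho> * (C2 f W \<beta> / 12 * (real CARD('d) * \<eta>\<^sup>2 * n)) \<le> \<eta> / 48 * n"
      by (simp add: power2_eq_square mult_ac)
    have 3: "\<rho> * (C2 f W \<beta> / 12 * (8 * u)) = s / 8 * u"
    proof -
      have "\<rho> * (C2 f W \<beta> / 12 * (8 * u)) = (\<rho> * C2 f W \<beta>) * (2 / 3 * u)"
        by simp
      also have "\<dots> = 3 / 16 * (1 - \<theta>\<^sup>2) * (2 / 3 * u)"
        by (simp only: rho_C2)
      also have "\<dots> = s / 8 * u"
        by (simp add: s_def)
      finally show ?thesis .
    qed
    have "\<rho> * (disagreement (D (Suc k)))\<^sup>2 \<le> \<rho> * ((1 + \<theta>\<^sup>2) / 2 * v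
        + C2 f W \<beta> / 12 * (8 * u + 2 * \<eta>\<^sup>2 * \<theta>\<^sup>2 * v + real CARD('d) * \<eta>\<^sup>2 * n))"
      using disagreement_D_Suc_sq[of k] rho_pos unfolding u_def v_def n_def by (intro mult_left_mono) auto
    also have "\<dots> = \<rho> * (1 - s / 2) * v + \<rho> * (C2 f W \<beta> / 12 * (8 * u))
        + \<rho> * (C2 f W \<beta> / 12 * (2 * \<eta>\<^sup>2 * \<theta>\<^sup>2 * v)) + \<rho> * (C2 f W \<beta> / 12 * (real CARD('d) * \<eta>\<^sup>2 * n))"
      by (simp add: s_def field_simps)
    finally show ?thesis
      using 1 2 3 by linarith
  qed
  have "0 \<le> \<rho> * s * v" "0 \<le> \<eta> * n" "0 \<le> s * u"
    using nonneg rho_pos eta_pos by auto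
  then show ?thesis
    using h U V unfolding merit_at_eq decrease_def u_def[symmetric] v_def[symmetric] s_def[symmetric]
    by (simp add: algebra_simps)
qed

end

section \<open>Limit points and rates\<close>

lemma Min_le_average:
  fixes g :: "nat \<Rightarrow> real"
  assumes "1 \<le> K" "0 < c" "\<And>k. k < K \<Longrightarrow> c * g k \<le> q k" "(\<Sum>k<K. q k) \<le> B"
  shows "(MIN k\<in>{0..K-1}. g k) \<le> B / (c * real K)"
proof -
  have "c * (MIN k\<in>{0..K-1}. g k) \<le> q k" if "k < K" for k
  proof -
    have "(MIN k\<in>{0..K-1}. g k) \<le> g k"
      using that by (intro Min_le) auto
    then have "c * (MIN k\<in>{0..K-1}. g k) \<le> c * g k"
      using assms(2) by (intro mult_left_mono) auto
    then show ?thesis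
      using assms(3)[OF that] by linarith
  qed
  then have "real (card {..<K}) * (c * (MIN k\<in>{0..K-1}. g k)) \<le> (\<Sum>k<K. q k)"
    by (intro sum_bounded_below) auto
  then have "(MIN k\<in>{0..K-1}. g k) * (c * real K) \<le> B"
    using assms(4) by (simp add: mult_ac)
  then show ?thesis
    using assms(1,2) by (simp add: pos_le_divide_eq)
qed

lemma tendsto_zero_if_weighted_le:
  fixes g :: "nat \<Rightarrow> real"
  assumes "q \<longlonglongrightarrow> 0" "0 < c" "\<And>k. c * g k \<le> q k" "\<And>k. 0 \<le> g k"
  shows "g \<longlonglongrightarrow> 0"
proof (rule tendsto_sandwich[OF _ _ tendsto_const])
  show "(\<lambda>k. q k / c) \<longlonglongrightarrow> 0"
    using tendsto_divide[OF assms(1) tendsto_const[of c]] assms(2) by simp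
  show "\<forall>\<^sub>F k in sequentially. g k \<le> q k / c"
    using assms(2,3) by (simp add: field_simps)
qed (use assms(4) in simp)

context smooth_problem
begin

text \<open>
  \<open>h\<close> is continuous, and \<open>region_R\<close> lies in a compact set.
\<close>

lemma h_fun_bounded_below_on_R: "\<exists>b. \<forall>X\<in>region_R. b \<le> h_fun f \<beta> X"
proof -
  have "isCont (h_fun f \<beta>) X" for X
    using GDERIV_h_fun[of \<beta> X] unfolding gderiv_def by (rule has_derivative_continuous)
  then have "continuous_on (region_B f) (h_fun f \<beta>)"
    by (intro continuous_at_imp_continuous_on) auto
  then obtain Y where "\<forall>X\<in>region_B f. h_fun f \<beta> Y \<le> h_fun f \<beta> X"
    using continuous_attains_inf[OF compact_region_B[of f]] zero_in_region_B by blast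
  then show ?thesis
    using region_R_subset_B by blast
qed

lemma continuous_on_G_objective: "continuous_on UNIV (G_loc (objective f))"
  by (intro continuous_on_UNIV_if_lipschitz_on_cballs has_lipschitz_on_G_loc smooth_objective compact_cball)

end

context destiny
begin

lemma decrease_ge:
  "\<eta> / 2 * (norm (G_avg f (avg (X k))))\<^sup>2 \<le> decrease k"
  "3 / 8 * \<eta> * \<beta> * (norm (defect (avg (X k))))\<^sup>2 \<le> decrease k"
  "(1 - \<theta>\<^sup>2) / 3 * (disagreement (X k))\<^sup>2 \<le> decrease k"
  "0 \<le> decrease k"
proof -
  have "0 \<le> \<eta> / 2 * (norm (G_avg f (avg (X k))))\<^sup>2" "0 \<le> 3 / 8 * \<eta> * \<beta> * (norm (defect (avg (X k))))\<^sup>2"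
    "0 \<le> (1 - \<theta>\<^sup>2) / 3 * (disagreement (X k))\<^sup>2"
    using eta_pos beta_bounds(1) one_minus_theta_sq_pos by auto
  then show "\<eta> / 2 * (norm (G_avg f (avg (X k))))\<^sup>2 \<le> decrease k"
    "3 / 8 * \<eta> * \<beta> * (norm (defect (avg (X k))))\<^sup>2 \<le> decrease k"
    "(1 - \<theta>\<^sup>2) / 3 * (disagreement (X k))\<^sup>2 \<le> decrease k"
    "0 \<le> decrease k"
    unfolding decrease_def by linarith+
qed

lemma sum_decrease_le: "\<exists>h_low. \<forall>K. (\<Sum>k<K. decrease k) \<le> merit_at 0 - h_low"
proof -
  obtain b where b: "\<And>Y. Y \<in> region_R \<Longrightarrow> b \<le> h_fun f \<beta> Y"
    using h_fun_bounded_below_on_R by blast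
  have "(\<Sum>k<K. decrease k) \<le> merit_at 0 - merit_at K" for K
  proof (induction K)
    case (Suc K)
    then show ?case
      using merit_descent[of K] by simp
  qed simp
  moreover have "b \<le> merit_at K" for K
    using b[OF avg_X_in_R[of K]] rho_pos unfolding merit_at_eq
    by (intro add_increasing2) auto
  ultimately show ?thesis
    by (intro exI[of _ b] allI) (smt (verit))
qed

lemma decrease_tendsto_0: "decrease \<longlonglongrightarrow> 0"
proof -
  obtain h where "\<And>K. (\<Sum>k<K. decrease k) \<le> merit_at 0 - h"
    using sum_decrease_le by blast
  then have "summable decrease"
    by (intro summableI_nonneg_bounded decrease_ge(4))
  then show ?thesis
    by (rule summable_LIMSEQ_zero)
qed

lemma disagreement_tendsto_0: "(\<lambda>k. disagreement (X k)) \<longlonglongrightarrow> 0"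
  and G_avg_tendsto_0: "(\<lambda>k. G_avg f (avg (X k))) \<longlonglongrightarrow> 0"
  and defect_tendsto_0: "(\<lambda>k. defect (avg (X k))) \<longlonglongrightarrow> 0"
proof -
  have "(\<lambda>k. (disagreement (X k))\<^sup>2) \<longlonglongrightarrow> 0"
    by (rule tendsto_zero_if_weighted_le[OF decrease_tendsto_0 _ decrease_ge(3)])
       (use one_minus_theta_sq_pos in auto)
  then show "(\<lambda>k. disagreement (X k)) \<longlonglongrightarrow> 0"
    by simp
  have "(\<lambda>k. (norm (G_avg f (avg (X k))))\<^sup>2) \<longlonglongrightarrow> 0"
    by (rule tendsto_zero_if_weighted_le[OF decrease_tendsto_0 _ decrease_ge(1)]) (use eta_pos in auto)
  then show "(\<lambda>k. G_avg f (avg (X k))) \<longlonglongrightarrow> 0"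
    by (simp add: tendsto_norm_zero_iff)
  have "(\<lambda>k. (norm (defect (avg (X k))))\<^sup>2) \<longlonglongrightarrow> 0"
    by (rule tendsto_zero_if_weighted_le[OF decrease_tendsto_0 _ decrease_ge(2)])
       (use eta_pos beta_bounds(1) in auto)
  then show "(\<lambda>k. defect (avg (X k))) \<longlonglongrightarrow> 0"
    by (simp add: tendsto_norm_zero_iff)
qed

lemma exists_accumulation_point:
  "\<exists>Xs Ds. accumulation_point (\<lambda>k. (stack (X k), stack (D k))) (Xs, Ds)"
proof -
  have X: "norm (stack (X k)) \<le> sqrt (real CARD('d)) + sqrt (real CARD('d)) * sqrt (7 * real CARD('p) / 6)" for k
  proof -
    have "disagreement (X k) \<le> sqrt (real CARD('d))"
      using controlled[of k] sqrt_card_div_L_le by (simp add: controlled_def)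
    moreover have "sqrt (real CARD('d)) * norm (avg (X k)) \<le> sqrt (real CARD('d)) * sqrt (7 * real CARD('p) / 6)"
      by (intro mult_left_mono norm_region_R avg_X_in_R) auto
    ultimately show ?thesis
      using norm_stack_le[of "X k"] by linarith
  qed
  have "bounded (range (\<lambda>k. stack (X k)))" "bounded (range (\<lambda>k. stack (D k)))"
    using X controlled_D(1)[OF controlled] unfolding bounded_iff by auto
  then have "bounded (range (\<lambda>k. stack (X k)) \<times> range (\<lambda>k. stack (D k)))"
    by (rule bounded_Times)
  then have "bounded (range (\<lambda>k. (stack (X k), stack (D k))))"
    by (rule bounded_subset) auto
  then obtain l r where "strict_mono r" "((\<lambda>k. (stack (X k), stack (D k))) \<circ> r) \<longlonglongrightarrow> l"
    using bounded_imp_convergent_subsequence by blast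
  then show ?thesis
    unfolding accumulation_point_def by (cases l) blast
qed

text \<open>
  All the maps involved are continuous, so the three quantities that vanish along the iterates
  vanish at the limit; on the Stiefel manifold \<open>G\<close> is the Riemannian gradient.
\<close>

lemma accumulation_point_stationary:
  assumes "accumulation_point (\<lambda>k. (stack (X k), stack (D k))) (Xs, Ds)"
  shows "Xs = replicate_blocks (block_mean Xs)" "first_order_stationary (objective f) (block_mean Xs)"
proof -
  obtain r where r: "strict_mono r" "((\<lambda>k. (stack (X k), stack (D k))) \<circ> r) \<longlonglongrightarrow> (Xs, Ds)"
    using assms unfolding accumulation_point_def by blast
  have sX: "(\<lambda>k. stack (X (r k))) \<longlonglongrightarrow> Xs"
    using tendsto_fst[OF r(2)] by (simp add: o_def)
  have sub: "(\<lambda>k. g (r k)) \<longlonglongrightarrow> l" if "g \<longlonglongrightarrow> l" for g :: "nat \<Rightarrow> 'z::topological_space" and l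
    using LIMSEQ_subseq_LIMSEQ[OF that r(1)] by (simp add: o_def)
  define Xb where "Xb = block_mean Xs"
  obtain Z where Z: "Xs = stack Z"
    using exists_stack by blast
  have "(\<lambda>k. J_mat ** stack (X (r k)) - stack (X (r k))) \<longlonglongrightarrow> J_mat ** Xs - Xs"
    by (intro tendsto_diff bounded_bilinear.tendsto[OF bounded_bilinear_matrix_mult] tendsto_const sX)
  moreover have "(\<lambda>k. J_mat ** stack (X (r k)) - stack (X (r k))) \<longlonglongrightarrow> 0"
    by (subst tendsto_norm_zero_iff[symmetric]) (simp add: norm_J_mat_stack sub[OF disagreement_tendsto_0])
  ultimately have "J_mat ** Xs - Xs = 0"
    by (rule LIMSEQ_unique)
  then show "Xs = replicate_blocks (block_mean Xs)"
    by (simp add: Z J_mat_stack replicate_blocks_eq block_mean_stack)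
  have "(\<lambda>k. block_mean (stack (X (r k)))) \<longlonglongrightarrow> Xb"
    unfolding Xb_def block_mean_def
    by (intro tendsto_scaleR bounded_bilinear.tendsto[OF bounded_bilinear_matrix_mult] tendsto_const sX)
  then have avgX: "(\<lambda>k. avg (X (r k))) \<longlonglongrightarrow> Xb"
    by (simp add: block_mean_stack)
  have "(\<lambda>k. defect (avg (X (r k)))) \<longlonglongrightarrow> defect Xb"
    unfolding defect_def
    by (intro tendsto_diff bounded_bilinear.tendsto[OF bounded_bilinear_matrix_mult]
        bounded_linear.tendsto[OF bounded_linear_transpose] tendsto_const avgX)
  then have "defect Xb = 0"
    using sub[OF defect_tendsto_0] by (rule LIMSEQ_unique)
  then have st: "Xb \<in> stiefel"
    by (simp add: stiefel_def defect_def)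
  have "(\<lambda>k. G_avg f (avg (X (r k)))) \<longlonglongrightarrow> G_loc (objective f) Xb"
    unfolding G_avg_eq by (rule continuous_on_tendsto_compose[OF continuous_on_G_objective avgX]) auto
  then have "G_loc (objective f) Xb = 0"
    using sub[OF G_avg_tendsto_0] by (rule LIMSEQ_unique)
  then show "first_order_stationary (objective f) (block_mean Xs)"
    using st by (simp add: first_order_stationary_def G_loc_stiefel Xb_def)
qed

text \<open>
  The lower bound of the merit function serves as \<open>h_low\<close>. The weights in \<open>decrease\<close> dominate
  those demanded by the rates, the third because \<open>L_f\<^sup>2 < \<beta> / 22\<close>.
\<close>

lemma rates:
  "\<exists>h_low. \<forall>K\<ge>1.
     (MIN k\<in>{0..K-1}. (disagreement (X k))\<^sup>2) \<le> 16 * (merit_at 0 - h_low) / (3 * (1 - \<theta>\<^sup>2) * real K) \<and>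
     (MIN k\<in>{0..K-1}. (norm (G_avg f (avg (X k))))\<^sup>2) \<le> 2 * (merit_at 0 - h_low) / (\<eta> * real K) \<and>
     (L_f f \<noteq> 0 \<longrightarrow> (MIN k\<in>{0..K-1}. (norm (defect (avg (X k))))\<^sup>2)
        \<le> 2 * (merit_at 0 - h_low) / (\<eta> * (L_f f)\<^sup>2 * real K))"
proof -
  obtain h_low where sum: "\<And>K. (\<Sum>k<K. decrease k) \<le> merit_at 0 - h_low"
    using sum_decrease_le by blast
  let ?B = "merit_at 0 - h_low"
  show ?thesis
  proof (intro exI[of _ h_low] allI impI conjI)
    fix K :: nat assume K: "1 \<le> K"
    have "3 * (1 - \<theta>\<^sup>2) / 16 * (disagreement (X k))\<^sup>2 \<le> decrease k" for k
    proof -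
      have "3 * (1 - \<theta>\<^sup>2) / 16 * (disagreement (X k))\<^sup>2 \<le> (1 - \<theta>\<^sup>2) / 3 * (disagreement (X k))\<^sup>2"
        using one_minus_theta_sq_pos by (intro mult_right_mono) auto
      then show ?thesis
        using decrease_ge(3)[of k] by linarith
    qed
    from Min_le_average[OF K _ this sum[of K]]
    show "(MIN k\<in>{0..K-1}. (disagreement (X k))\<^sup>2) \<le> 16 * ?B / (3 * (1 - \<theta>\<^sup>2) * real K)"
      using one_minus_theta_sq_pos by (simp add: field_simps)
    from Min_le_average[OF K _ decrease_ge(1) sum[of K]]
    show "(MIN k\<in>{0..K-1}. (norm (G_avg f (avg (X k))))\<^sup>2) \<le> 2 * ?B / (\<eta> * real K)"
      using eta_pos by (simp add: field_simps)
    assume Lf: "L_f f \<noteq> 0"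
    have "\<eta> * (L_f f)\<^sup>2 / 2 * (norm (defect (avg (X k))))\<^sup>2 \<le> decrease k" for k
    proof -
      have "\<eta> * ((L_f f)\<^sup>2 / 2) \<le> \<eta> * (3 / 8 * \<beta>)"
        using eta_pos beta_bounds(1,5) by (intro mult_left_mono) auto
      then have "\<eta> * (L_f f)\<^sup>2 / 2 * (norm (defect (avg (X k))))\<^sup>2 \<le> 3 / 8 * \<eta> * \<beta> * (norm (defect (avg (X k))))\<^sup>2"
        by (intro mult_right_mono) auto
      then show ?thesis
        using decrease_ge(2)[of k] by linarith
    qed
    from Min_le_average[OF K _ this sum[of K]]
    show "(MIN k\<in>{0..K-1}. (norm (defect (avg (X k))))\<^sup>2) \<le> 2 * ?B / (\<eta> * (L_f f)\<^sup>2 * real K)"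
      using eta_pos Lf by (simp add: field_simps)
  qed
qed

end

theorem theorem3p8:
  fixes f :: "'d::finite \<Rightarrow> real^'p::finite^'n::finite \<Rightarrow> real"
    and E :: "('d \<times> 'd) set"
    and W :: "real^'d^'d"
    and \<beta> \<eta> :: real
    and X_init :: "real^'p^'n"
    and X D :: "nat \<Rightarrow> 'd \<Rightarrow> real^'p^'n"
  assumes dims: "CARD('p) \<le> CARD('n)"
    and smooth: "\<And>i. has_loc_lipschitz_gradient (f i)"
    and graph: "connected_graph E"
    and mixing: "mixing_matrix E W"
    and penalty: "penalty_condition f \<beta>"
    and stepsize: "stepsize_condition f W \<beta> (stack (D 0)) \<eta>"
    and init: "X_init \<in> region_R"
    and iterates: "destiny_iterates f W \<beta> \<eta> X_init X D"
  shows
    "(\<exists>Xs Ds. accumulation_point (\<lambda>k. (stack (X k), stack (D k))) (Xs, Ds)) \<and>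
     (\<forall>Xs Ds. accumulation_point (\<lambda>k. (stack (X k), stack (D k))) (Xs, Ds) \<longrightarrow>
        Xs = replicate_blocks (block_mean Xs) \<and>
        first_order_stationary (objective f) (block_mean Xs)) \<and>
     (\<exists>h_low :: real. \<forall>K\<ge>1.
        (MIN k\<in>{0..K-1}. (norm (J_mat ** stack (X k) - stack (X k)))\<^sup>2)
          \<le> 16 * (merit f W \<beta> (stack (X 0)) (stack (D 0)) - h_low)
              / (3 * (1 - (mixing_rate W)\<^sup>2) * real K) \<and>
        (MIN k\<in>{0..K-1}. (norm (G_avg f (avg (X k))))\<^sup>2)
          \<le> 2 * (merit f W \<beta> (stack (X 0)) (stack (D 0)) - h_low) / (\<eta> * real K) \<and>
        (L_f f \<noteq> 0 \<longrightarrow>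
          (MIN k\<in>{0..K-1}. (norm (transpose (avg (X k)) ** avg (X k) - mat 1))\<^sup>2)
            \<le> 2 * (merit f W \<beta> (stack (X 0)) (stack (D 0)) - h_low)
                / (\<eta> * (L_f f)\<^sup>2 * real K)))"
proof -
  interpret destiny f E W \<beta> \<eta> X_init X D
    by unfold_locales (use smooth mixing penalty stepsize init iterates in auto)
  show ?thesis
    using exists_accumulation_point accumulation_point_stationary rates
    by (simp add: norm_J_mat_stack flip: merit_at_def defect_def)
qed

end
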